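(* ($\mathrm{Delay}\,A$ is the free delay algebra on $A$.) Let $A,B$ be types of the guarded calculus described in the context, and let $\mathrm{ext}:(\triangleright B\to B)\to(A\to B)\to\mathrm{Delay}\,A\to B$ be the closed term defined there by guarded recursion. Then the following closed propositions are provable in the logic (from the empty hypothesis context): (1) $\forall s:\triangleright B\to B.\ \forall f:A\to B.\ \forall a:A.\ \mathrm{ext}\,s\,f\,(\mathrm{ret}\,a)=f\,a$; (2) $\forall s:\triangleright B\to B.\ \forall f:A\to B.\ \forall w:\triangleright(\mathrm{Delay}\,A).\ \mathrm{ext}\,s\,f\,(\mathrm{step}\,w)=s\,(\mathsf{delay}(\mathrm{ext}\,s\,f\,(\mathsf{adv}_1w)))$; (3) (uniqueness) $\forall s:\triangleright B\to B.\ \forall f:A\to B.\ \forall h:\mathrm{Delay}\,A\to B.\ (\forall a.\ h(\mathrm{ret}\,a)=f\,a)\to(\forall w.\ h(\mathrm{step}\,w)=s(\mathsf{delay}(h(\mathsf{adv}_1w))))\to h=\mathrm{ext}\,s\,f$.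
   Context: **Model.** $\mathcal T$ is the topos of trees: presheaves $X$ of (small) sets on $\omega$, i.e. sets $X(n)$, $n\ge 0$, with restriction maps $x\mapsto x|_k$ for $k\le n$. $\triangleright X(0)=1$, $\triangleright X(n+1)=X(n)$; its left adjoint is $(\blacktriangleleft X)(n)=X(n+1)$. $\Omega(n)$ is the set of downward closed subsets (sieves) of $\{0,\dots,n\}$, restricted by intersection. **Types.** $\tau,\sigma::=\Delta T\mid\tau\times\sigma\mid\tau\oplus\sigma\mid\tau\to\sigma\mid\triangleright\tau\mid\Omega\mid\mathsf{ax}\,I$, with $T$ a set (a type of the metatheory) and $I$ an object of $\mathcal T$. $[\![\Delta T]\!]$ is the constant presheaf, $[\![\mathsf{ax}\,I]\!]=I$, the others are product, coproduct, exponential, $\triangleright$, subobject classifier of $\mathcal T$. **Terms** (de Bruijn, carrying type annotations, partly suppressed, so that types of terms are unique): $\delta(a)$, $e\odot e'$, $\mathsf{pure}\,e$, $\mathsf{var}(p,q)$, $\mathsf{lam}_\tau e$, $\mathsf{app}\,e\,e'$, $\mathsf{delay}\,e$, $\mathsf{adv}_n e$, $\mathsf{fix}\,e$, $\langle e,e'\rangle$, $\mathsf{proj}\,e\,L$, $\mathsf{proj}\,e\,R$, $\mathsf{inl}\,e$, $\mathsf{inr}\,e$, $\mathsf{case}\,e\,f\,g$, $\Phi\wedge\Phi'$, $\Phi\vee\Phi'$, $\Phi\to\Phi'$, $\forall_\tau\Phi$, $\exists_\tau\Phi$, $\mathsf{lift}\,e$, $\top$, $\bot$, $e=_\tau e'$,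 $\mathsf{ax}_\tau f$ (with $f:1\to[\![\tau]\!]$ in $\mathcal T$). A frame $\Gamma$ is a list of types; a context $\vec\Gamma=\Gamma_0;\dots;\Gamma_n$ is a stack of at least one frame, $\Gamma_0$ innermost; $\cdot$ is the empty frame. Binders $\mathsf{lam},\mathsf{fix},\forall,\exists$ bind slot 0 of the innermost frame; $\mathsf{delay}$ pushes an empty frame. Named variables below abbreviate de Bruijn indices. **Typing** $\vec\Gamma\vdash e:\tau$ ($|\vec\Gamma|>0$ always): $\delta(a):\Delta T$ for $a\in T$; $f\odot x:\Delta S$ if $f:\Delta(T\to S)$, $x:\Delta T$; $\mathsf{pure}\,e:\Omega$ if $e:\Delta\mathrm{Prop}$; $\mathsf{ax}_\tau f:\tau$; $\mathsf{var}(p,q)$ has the type of slot $q$ (from 0) of frame $\Gamma_p$; $\Gamma;\vec\Gamma\vdash\mathsf{lam}_\tau e:\tau\to\sigma$ if $(\tau,\Gamma);\vec\Gamma\vdash e:\sigma$; $\vec\Gamma\vdash\mathsf{delay}\,e:\triangleright\tau$ if $\cdot;\vec\Gamma\vdash e:\tau$; $\Gamma_1;\dots;\Gamma_n;\vec\Gamma\vdash\mathsf{adv}_n e:\tau$ if $n>0$ and $\vec\Gamma\vdash e:\triangleright\tau$; $\Gamma;\vec\Gamma\vdash\mathsf{fix}\,e:\tau$ if $(\triangleright\tau,\Gamma);\vec\Gamma\vdash e:\tau$; $\Gamma;\vec\Gamma\vdash\forall_\tau\Phi,\exists_\tau\Phi:\Omega$ if $(\tau,\Gamma);\vec\Gamma\vdash\Phi:\Omega$;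 $\mathsf{lift}\,e:\Omega$ if $e:\triangleright\Omega$; $\mathsf{case}\,e\,f\,g:\rho$ if $e:\tau\oplus\sigma$, $f:\tau\to\rho$, $g:\sigma\to\rho$; application, pairs, projections, injections, connectives, $\top,\bot$ and $e=_\tau e':\Omega$ (for $e,e':\tau$) as usual. **Renaming and substitution.** Traverse a term recording the number $d$ of frames entered and, for each entered frame and the original innermost frame, the number of binders passed; $\mathsf{delay}$ raises $d$ by 1; $\mathsf{adv}_m$ with $m\le d$ returns to depth $d-m$ (with that frame's binder count). $\Uparrow^k e$ (weakening past $k$ new frames): $\mathsf{var}(p,q)$ with $p\ge d$ becomes $\mathsf{var}(p+k,q)$; $\mathsf{adv}_m e'$ with $m>d$ becomes $\mathsf{adv}_{m+k}e'$ with $e'$ unchanged; all else is structural. $\uparrow e$ (new slot in the innermost frame): $\mathsf{var}(d,q)$ with $q\ge j$, $j$ the number of binders passed in the original frame, becomes $\mathsf{var}(d,q+1)$; bodies of $\mathsf{adv}_m$ with $m>d$ are unchanged. $e[e']$: capture-avoiding substitution for $\mathsf{var}(0,0)$: $\mathsf{var}(d,j)$ becomes $\Uparrow^d\uparrow^j e'$, $\mathsf{var}(d,q)$ with $q>j$ becomes $\mathsf{var}(d,q-1)$; bodies of $\mathsf{adv}_m$ with $m>d$ are unchanged. **Interpretation.** $[\![\Gamma;\vec\Gamma]\!]=[\![\Gamma]\!]\times\blacktriangleleft[\![\vec\Gamma]\!]$, a single frame being the product of its types. A well-typed $e$ is a morphism $[\![e]\!]:[\![\vec\Gamma]\!]\to[\![\tau]\!]$.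 For $\gamma\in[\![\vec\Gamma]\!](n)$: $\mathsf{var}(p,q)$: the $q$-th component of the part of $\gamma$ in $[\![\Gamma_p]\!](n+p)$, restricted to $n$; $[\![\mathsf{delay}\,e]\!]_0=*$, $[\![\mathsf{delay}\,e]\!]_{n+1}(\gamma)=[\![e]\!]_n( *,\gamma)$; $[\![\mathsf{adv}_k e]\!]_n(\gamma)=[\![e]\!]_{n+1}(\gamma'|_{n+1})$, $\gamma'\in[\![\vec\Gamma]\!](n+k)$ the part of $\gamma$ beyond the first $k$ frames; $[\![\mathsf{fix}\,e]\!]_0(\gamma)=[\![e]\!]_0( *,\gamma)$, $[\![\mathsf{fix}\,e]\!]_{n+1}(\gamma)=[\![e]\!]_{n+1}([\![\mathsf{fix}\,e]\!]_n(\gamma|_n),\gamma)$; $\delta(a)$ constant $a$; $\odot$ application; $\mathsf{ax}_\tau f$ is $f$ after the terminal map; $\mathsf{pure}\,e$ is the full sieve if the truth value is true, else empty; $\mathsf{lift}$ at stage 0 is $\{0\}$ and at stage $n+1$ sends $S\in\Omega(n)$ to $\{0\}\cup\{k+1:k\in S\}$; $e=_\tau e'$ is $\{k\le n:[\![e]\!]_n(\gamma)|_k=[\![e']\!]_n(\gamma)|_k\}$; connectives, quantifiers, functions, products, sums standard in $\mathcal T$. **Judgmental equality** $\vec\Gamma\vdash e\equiv e':\tau$ (both sides well typed): the least congruence (equivalence relation closed under all term formers, with contexts changing as in typing) containing: $\beta,\eta$ for functions and products; $\mathsf{case}(\mathsf{inl}\,a)fg\equiv fa$, $\mathsf{case}(\mathsf{inr}\,b)fg\equiv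 gb$; $\delta(f)\odot\delta(x)\equiv\delta(fx)$; $\mathsf{adv}_n(\mathsf{delay}\,e)\equiv\Uparrow^{n-1}e$ ($n>0$, $\cdot;\vec\Gamma\vdash e:\tau$); $e\equiv\mathsf{delay}(\mathsf{adv}_1e)$ at $\triangleright\tau$; $\mathsf{fix}\,e\equiv e[\mathsf{delay}(\Uparrow^1\mathsf{fix}\,e)]$; and $e\equiv e'$ whenever both are well typed and $[\![e]\!]=[\![e']\!]$. **Provability** $\vec\Gamma\mid\vec\Psi\vdash\Phi$, where $\vec\Psi=\Psi_0;\dots;\Psi_n$ is a stack of lists of propositions, $|\vec\Psi|=|\vec\Gamma|$, $\Psi_0$ innermost; displayed formulas and terms are assumed well typed. Write $\blacktriangleright\Phi:=\mathsf{lift}(\mathsf{delay}\,\Phi)$. Rules: (asm) $\Uparrow^k\Phi$ is provable for $\Phi\in\Psi_k$; the usual natural deduction introduction/elimination rules for $\top,\bot,\wedge,\vee,\to$, new hypotheses going to the innermost hypothesis frame; usual rules for $\forall_\tau,\exists_\tau$ where the fresh variable extends the innermost frame $\Gamma_0$ and hypotheses in $\Psi_0$ (and the conclusion, in $\exists$-elimination) are weakened by $\uparrow$, instantiation being $\Phi[e]$; from $\Phi[\delta(a)]$ for all $a\in T$ infer $\forall_{\Delta T}\Phi$; sum elimination: for $e:\tau\oplus\sigma$, to prove $\Phi$ it suffices to prove $\uparrow\Phi$ with fresh $x:\tau$ and hypothesis $\uparrow e=\mathsf{inl}\,x$, and with fresh $x:\sigma$ and hypothesis $\uparrow e=\mathsf{inr}\,x$;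 from $\cdot;\vec\Gamma\mid\cdot;\vec\Psi\vdash\Phi$ infer $\vec\Gamma\mid\vec\Psi\vdash\blacktriangleright\Phi$; from $\vec\Gamma\mid\vec\Psi\vdash\blacktriangleright P$ and $\cdot;\vec\Gamma\mid P;\vec\Psi\vdash Q$ infer $\vec\Gamma\mid\vec\Psi\vdash\blacktriangleright Q$; from $\blacktriangleright P,\blacktriangleright Q$ infer $\blacktriangleright(P\wedge Q)$; from $\blacktriangleright(P\vee Q)$ infer $\blacktriangleright P\vee\blacktriangleright Q$; (Löb) from $\vec\Gamma\mid(\blacktriangleright(\Uparrow^1\Phi),\Psi);\vec\Psi\vdash\Phi$ infer $\vec\Gamma\mid\Psi;\vec\Psi\vdash\Phi$; from $\blacktriangleright(e_1=_\tau e_2)$ infer $\mathsf{delay}\,e_1=_{\triangleright\tau}\mathsf{delay}\,e_2$; from $\vec\Gamma\vdash e_1\equiv e_2:\tau$ infer $e_1=_\tau e_2$; from $e_1=_\tau e_2$ and $\Phi[e_1]$ infer $\Phi[e_2]$; if the metatheoretic proposition $P$ holds, infer $\mathsf{pure}\,\delta(P)$; injectivity of $\mathsf{inl},\mathsf{inr}$; from $\mathsf{inl}\,a=\mathsf{inr}\,b$ infer $\bot$. A closed proposition $\Phi$ is provable if $\cdot\mid\cdot\vdash\Phi$. **Delay.** Let $D_A$ be the object of $\mathcal T$ (unique up to isomorphism) with an isomorphism $\theta:[\![A]\!]+\triangleright D_A\cong D_A$; $\mathrm{Delay}\,A:=\mathsf{ax}\,D_A$, and $\mathrm{MK}:A\oplus\triangleright(\mathrm{Delay}\,A)\to\mathrm{Delay}\,A$,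 $\mathrm{PROJ}:\mathrm{Delay}\,A\to A\oplus\triangleright(\mathrm{Delay}\,A)$ are the closed constants (via $\mathsf{ax}$) denoting $\theta,\theta^{-1}$. $\mathrm{ret}:=\lambda a.\,\mathrm{MK}(\mathsf{inl}\,a)$, $\mathrm{step}:=\lambda w.\,\mathrm{MK}(\mathsf{inr}\,w)$. A delay algebra is a type $B$ with a map $s:\triangleright B\to B$. The extension is $$\mathrm{ext}:=\mathsf{fix}\,\mu.\ \lambda s.\lambda f.\lambda d.\ \mathsf{case}\,(\mathrm{PROJ}\,d)\,(\lambda a.\,f\,a)\,(\lambda w.\,s(\mathsf{delay}((\mathsf{adv}_1\mu)\,s\,f\,(\mathsf{adv}_1w)))).$$ *)

theory Defs
  imports Main
begin

section \<open>Small sets\<close>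

text \<open>
  HOL cannot construct a type that contains arbitrarily iterated function spaces over all of its
  own small sets, so the universe of small sets is a parameter: a type with a membership structure
  satisfying extensionality, separation, union, power set and (second-order) replacement.
  Infinity and foundation are not needed and not required; thus both the class of all sets of
  ZF and the hereditarily finite sets are models.
\<close>

class small_sets =
  fixes elts :: "'a \<Rightarrow> 'a set"
  assumes elts_ext: "elts x = elts y \<Longrightarrow> x = y"
    and elts_subset: "Y \<subseteq> elts x \<Longrightarrow> Y \<in> range elts"
    and elts_Union: "\<Union> (elts ` elts x) \<in> range elts"
    and elts_Pow: "{y. elts y \<subseteq> elts x} \<in> range elts"
    and elts_replacement: "f ` elts x \<in> range elts"

definition vset :: "'v::small_sets set \<Rightarrow> 'v" where
  "vset = inv elts"

definition vpair :: "'v::small_sets \<Rightarrow> 'v \<Rightarrow> 'v" where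
  "vpair x y = vset {vset {x}, vset {x, y}}"

definition vfst :: "'v::small_sets \<Rightarrow> 'v" where
  "vfst p = (THE x. \<exists>y. p = vpair x y)"

definition vsnd :: "'v::small_sets \<Rightarrow> 'v" where
  "vsnd p = (THE y. \<exists>x. p = vpair x y)"

primrec vnat :: "nat \<Rightarrow> 'v::small_sets" where
  "vnat 0 = vset {}"
| "vnat (Suc n) = vset (insert (vnat n) (elts (vnat n)))"

definition vinl :: "'v::small_sets \<Rightarrow> 'v" where
  "vinl x = vpair (vnat 0) x"

definition vinr :: "'v::small_sets \<Rightarrow> 'v" where
  "vinr x = vpair (vnat 1) x"

definition vlam :: "'v::small_sets \<Rightarrow> ('v \<Rightarrow> 'v) \<Rightarrow> 'v" where
  "vlam T f = vset ((\<lambda>x. vpair x (f x)) ` elts T)"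

definition vapp :: "'v::small_sets \<Rightarrow> 'v \<Rightarrow> 'v" where
  "vapp f x = (THE y. vpair x y \<in> elts f)"

definition vfunset :: "'v::small_sets \<Rightarrow> 'v \<Rightarrow> 'v" where
  "vfunset T S = vset {vlam T f | f. \<forall>x\<in>elts T. f x \<in> elts S}"

text \<open>Finite families indexed by the stages \<open>0, \<dots>, n\<close>.\<close>

definition vfam :: "nat \<Rightarrow> (nat \<Rightarrow> 'v) \<Rightarrow> 'v::small_sets" where
  "vfam n F = vset ((\<lambda>k. vpair (vnat k) (F k)) ` {..n})"

definition vcomp :: "'v::small_sets \<Rightarrow> nat \<Rightarrow> 'v" where
  "vcomp v k = vapp v (vnat k)"

definition vstar :: "'v::small_sets" where
  "vstar = vset {}"

text \<open>The set of truth values, that is, the metatheoretic type of propositions.\<close>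

definition vtruth :: "bool \<Rightarrow> 'v::small_sets" where
  "vtruth P = (if P then vnat 1 else vnat 0)"

definition vProp :: "'v::small_sets" where
  "vProp = vset (range vtruth)"

definition enc :: "nat set \<Rightarrow> 'v::small_sets" where
  "enc S = vset (vnat ` S)"

definition dec :: "'v::small_sets \<Rightarrow> nat set" where
  "dec v = {k. vnat k \<in> elts v}"


section \<open>Objects of the topos of trees\<close>

text \<open>
  \<open>r n k x\<close> is the restriction of \<open>x\<close> from stage \<open>n\<close> to stage \<open>k\<close>.  Requiring \<open>r\<close> to be
  \<open>undefined\<close> elsewhere makes equality in the type below the equality of presheaves.
\<close>

definition is_presheaf :: "(nat \<Rightarrow> 'v::small_sets) \<Rightarrow> (nat \<Rightarrow> nat \<Rightarrow> 'v \<Rightarrow> 'v) \<Rightarrow> bool" where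
  "is_presheaf X r \<longleftrightarrow>
     (\<forall>n k x. k \<le> n \<longrightarrow> x \<in> elts (X n) \<longrightarrow> r n k x \<in> elts (X k)) \<and>
     (\<forall>n x. x \<in> elts (X n) \<longrightarrow> r n n x = x) \<and>
     (\<forall>n k j x. j \<le> k \<longrightarrow> k \<le> n \<longrightarrow> x \<in> elts (X n) \<longrightarrow> r k j (r n k x) = r n j x) \<and>
     (\<forall>n k x. \<not> (k \<le> n \<and> x \<in> elts (X n)) \<longrightarrow> r n k x = undefined)"

typedef (overloaded) ('v::small_sets) presheaf =
  "{(X :: nat \<Rightarrow> 'v, r). is_presheaf X r}"
proof -
  obtain e :: 'v where e: "elts e = {}"
    using elts_subset[of "{}"] by fastforce
  have "is_presheaf (\<lambda>_. e) (\<lambda>_ _ _. undefined)"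
    by (simp add: is_presheaf_def e)
  then show ?thesis by blast
qed

definition psh_ob :: "'v::small_sets presheaf \<Rightarrow> nat \<Rightarrow> 'v" where
  "psh_ob I = fst (Rep_presheaf I)"

definition psh_res :: "'v::small_sets presheaf \<Rightarrow> nat \<Rightarrow> nat \<Rightarrow> 'v \<Rightarrow> 'v" where
  "psh_res I = snd (Rep_presheaf I)"


section \<open>Types and their interpretation\<close>

declare [[typedef_overloaded]]

datatype ('v::small_sets) ty =
    TDelta 'v
  | TProd "'v ty" "'v ty"
  | TSum "'v ty" "'v ty"
  | TFun "'v ty" "'v ty"
  | TLater "'v ty"
  | TOmega
  | TAx "'v presheaf"

text \<open>
  An element of an exponential at stage \<open>n\<close> is a natural family of functions at the
  stages \<open>k \<le> n\<close>.
\<close>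

primrec tres :: "'v::small_sets ty \<Rightarrow> nat \<Rightarrow> nat \<Rightarrow> 'v \<Rightarrow> 'v" where
  "tres (TDelta T) n k x = x"
| "tres (TProd t s) n k x = vpair (tres t n k (vfst x)) (tres s n k (vsnd x))"
| "tres (TSum t s) n k x =
     (if vfst x = vnat 0 then vinl (tres t n k (vsnd x)) else vinr (tres s n k (vsnd x)))"
| "tres (TFun t s) n k x = vfam k (vcomp x)"
| "tres (TLater t) n k x = (case k of 0 \<Rightarrow> vstar | Suc k' \<Rightarrow> tres t (n - 1) k' x)"
| "tres TOmega n k x = enc (dec x \<inter> {..k})"
| "tres (TAx I) n k x = psh_res I n k x"

primrec tob :: "'v::small_sets ty \<Rightarrow> nat \<Rightarrow> 'v" where
  "tob (TDelta T) n = T"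
| "tob (TProd t s) n = vset {vpair x y | x y. x \<in> elts (tob t n) \<and> y \<in> elts (tob s n)}"
| "tob (TSum t s) n = vset (vinl ` elts (tob t n) \<union> vinr ` elts (tob s n))"
| "tob (TFun t s) n =
     vset {vfam n (\<lambda>k. vlam (tob t k) (f k)) | f.
       \<forall>k\<le>n. \<forall>x\<in>elts (tob t k). f k x \<in> elts (tob s k) \<and>
         (\<forall>j\<le>k. f j (tres t k j x) = tres s k j (f k x))}"
| "tob (TLater t) n = (case n of 0 \<Rightarrow> vset {vstar} | Suc m \<Rightarrow> tob t m)"
| "tob TOmega n = vset {enc S | S. S \<subseteq> {..n} \<and> (\<forall>k\<in>S. \<forall>j\<le>k. j \<in> S)}"
| "tob (TAx I) n = psh_ob I n"

definition global_element :: "'v::small_sets ty \<Rightarrow> (nat \<Rightarrow> 'v) \<Rightarrow> bool" where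
  "global_element t f \<longleftrightarrow>
     (\<forall>n. f n \<in> elts (tob t n)) \<and> (\<forall>n. \<forall>k\<le>n. tres t n k (f n) = f k)"

definition morphism :: "'v::small_sets ty \<Rightarrow> 'v ty \<Rightarrow> (nat \<Rightarrow> 'v \<Rightarrow> 'v) \<Rightarrow> bool" where
  "morphism t s f \<longleftrightarrow>
     (\<forall>n. \<forall>x\<in>elts (tob t n). f n x \<in> elts (tob s n) \<and>
        (\<forall>k\<le>n. f k (tres t n k x) = tres s n k (f n x)))"

definition isomorphism ::
    "'v::small_sets ty \<Rightarrow> 'v ty \<Rightarrow> (nat \<Rightarrow> 'v \<Rightarrow> 'v) \<Rightarrow> (nat \<Rightarrow> 'v \<Rightarrow> 'v) \<Rightarrow> bool" where
  "isomorphism t s f g \<longleftrightarrow> morphism t s f \<and> morphism s t g \<and>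
     (\<forall>n. \<forall>x\<in>elts (tob t n). g n (f n x) = x) \<and>
     (\<forall>n. \<forall>y\<in>elts (tob s n). f n (g n y) = y)"


section \<open>Terms, contexts and typing\<close>

datatype side = L | R

text \<open>
  \<open>Const T a\<close> is \<open>\<delta>(a)\<close> at type \<open>\<Delta> T\<close>; \<open>Odot T S\<close> carries the domain and codomain of the
  function; \<open>InL s\<close> and \<open>InR t\<close> carry the type of the other summand; in \<open>AxC t f\<close> the
  map \<open>f : 1 \<rightarrow> t\<close> is given by its values.
\<close>

datatype ('v::small_sets) tm =
    Const 'v 'v
  | Odot 'v 'v "'v tm" "'v tm"
  | Pure "'v tm"
  | Var nat nat
  | Lam "'v ty" "'v tm"
  | App "'v tm" "'v tm"
  | Delay "'v tm"
  | Adv nat "'v tm"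
  | Fix "'v ty" "'v tm"
  | Tuple "'v tm" "'v tm"
  | Proj "'v tm" side
  | InL "'v ty" "'v tm"
  | InR "'v ty" "'v tm"
  | Case "'v tm" "'v tm" "'v tm"
  | And "'v tm" "'v tm"
  | Or "'v tm" "'v tm"
  | Imp "'v tm" "'v tm"
  | Forall "'v ty" "'v tm"
  | Exists "'v ty" "'v tm"
  | Lift "'v tm"
  | Top
  | Bot
  | Eq "'v ty" "'v tm" "'v tm"
  | AxC "'v ty" "nat \<Rightarrow> 'v"

type_synonym 'v ctx = "'v ty list list"

text \<open>The head of a context is its innermost frame; \<open>push\<close> adds slot 0 to that frame.\<close>

fun push :: "'a \<Rightarrow> 'a list list \<Rightarrow> 'a list list" where
  "push x (G # C) = (x # G) # C"
| "push x [] = [[x]]"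

inductive typed :: "'v::small_sets ctx \<Rightarrow> 'v tm \<Rightarrow> 'v ty \<Rightarrow> bool"
    ("(_/ \<turnstile> _/ \<Colon> _)" [51, 51, 51] 50) where
  "C \<noteq> [] \<Longrightarrow> a \<in> elts T \<Longrightarrow> C \<turnstile> Const T a \<Colon> TDelta T"
| "C \<turnstile> f \<Colon> TDelta (vfunset T S) \<Longrightarrow> C \<turnstile> x \<Colon> TDelta T \<Longrightarrow> C \<turnstile> Odot T S f x \<Colon> TDelta S"
| "C \<turnstile> e \<Colon> TDelta vProp \<Longrightarrow> C \<turnstile> Pure e \<Colon> TOmega"
| "p < length C \<Longrightarrow> q < length (C ! p) \<Longrightarrow> C \<turnstile> Var p q \<Colon> C ! p ! q"
| "(t # G) # C \<turnstile> e \<Colon> s \<Longrightarrow> G # C \<turnstile> Lam t e \<Colon> TFun t s"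
| "C \<turnstile> f \<Colon> TFun t s \<Longrightarrow> C \<turnstile> e \<Colon> t \<Longrightarrow> C \<turnstile> App f e \<Colon> s"
| "C \<noteq> [] \<Longrightarrow> [] # C \<turnstile> e \<Colon> t \<Longrightarrow> C \<turnstile> Delay e \<Colon> TLater t"
| "n > 0 \<Longrightarrow> length Gs = n \<Longrightarrow> C \<turnstile> e \<Colon> TLater t \<Longrightarrow> Gs @ C \<turnstile> Adv n e \<Colon> t"
| "(TLater t # G) # C \<turnstile> e \<Colon> t \<Longrightarrow> G # C \<turnstile> Fix t e \<Colon> t"
| "C \<turnstile> a \<Colon> t \<Longrightarrow> C \<turnstile> b \<Colon> s \<Longrightarrow> C \<turnstile> Tuple a b \<Colon> TProd t s"
| "C \<turnstile> e \<Colon> TProd t s \<Longrightarrow> C \<turnstile> Proj e L \<Colon> t"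
| "C \<turnstile> e \<Colon> TProd t s \<Longrightarrow> C \<turnstile> Proj e R \<Colon> s"
| "C \<turnstile> e \<Colon> t \<Longrightarrow> C \<turnstile> InL s e \<Colon> TSum t s"
| "C \<turnstile> e \<Colon> s \<Longrightarrow> C \<turnstile> InR t e \<Colon> TSum t s"
| "C \<turnstile> e \<Colon> TSum t s \<Longrightarrow> C \<turnstile> f \<Colon> TFun t r \<Longrightarrow> C \<turnstile> g \<Colon> TFun s r \<Longrightarrow> C \<turnstile> Case e f g \<Colon> r"
| "C \<turnstile> P \<Colon> TOmega \<Longrightarrow> C \<turnstile> Q \<Colon> TOmega \<Longrightarrow> C \<turnstile> And P Q \<Colon> TOmega"
| "C \<turnstile> P \<Colon> TOmega \<Longrightarrow> C \<turnstile> Q \<Colon> TOmega \<Longrightarrow> C \<turnstile> Or P Q \<Colon> TOmega"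
| "C \<turnstile> P \<Colon> TOmega \<Longrightarrow> C \<turnstile> Q \<Colon> TOmega \<Longrightarrow> C \<turnstile> Imp P Q \<Colon> TOmega"
| "(t # G) # C \<turnstile> P \<Colon> TOmega \<Longrightarrow> G # C \<turnstile> Forall t P \<Colon> TOmega"
| "(t # G) # C \<turnstile> P \<Colon> TOmega \<Longrightarrow> G # C \<turnstile> Exists t P \<Colon> TOmega"
| "C \<turnstile> e \<Colon> TLater TOmega \<Longrightarrow> C \<turnstile> Lift e \<Colon> TOmega"
| "C \<noteq> [] \<Longrightarrow> C \<turnstile> Top \<Colon> TOmega"
| "C \<noteq> [] \<Longrightarrow> C \<turnstile> Bot \<Colon> TOmega"
| "C \<turnstile> e \<Colon> t \<Longrightarrow> C \<turnstile> e' \<Colon> t \<Longrightarrow> C \<turnstile> Eq t e e' \<Colon> TOmega"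
| "C \<noteq> [] \<Longrightarrow> global_element t f \<Longrightarrow> C \<turnstile> AxC t f \<Colon> t"


section \<open>Renaming and substitution\<close>

text \<open>
  The list \<open>bs\<close> holds the number of binders passed in each entered frame, innermost first, and
  ends with that of the original frame; so \<open>d = length bs - 1\<close> frames have been entered.
  \<open>v\<close> acts on variables and \<open>a\<close> on the index of those \<open>Adv\<close> that leave the original frame.
\<close>

primrec traverse ::
    "(nat list \<Rightarrow> nat \<Rightarrow> nat \<Rightarrow> 'v tm) \<Rightarrow> (nat \<Rightarrow> nat) \<Rightarrow> nat list \<Rightarrow> 'v::small_sets tm \<Rightarrow> 'v tm" where
  "traverse v a bs (Const T c) = Const T c"
| "traverse v a bs (Odot T S f x) = Odot T S (traverse v a bs f) (traverse v a bs x)"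
| "traverse v a bs (Pure e) = Pure (traverse v a bs e)"
| "traverse v a bs (Var p q) = v bs p q"
| "traverse v a bs (Lam t e) = Lam t (traverse v a (Suc (hd bs) # tl bs) e)"
| "traverse v a bs (App f e) = App (traverse v a bs f) (traverse v a bs e)"
| "traverse v a bs (Delay e) = Delay (traverse v a (0 # bs) e)"
| "traverse v a bs (Adv m e) =
     (if m \<le> length bs - 1 then Adv m (traverse v a (drop m bs) e) else Adv (a m) e)"
| "traverse v a bs (Fix t e) = Fix t (traverse v a (Suc (hd bs) # tl bs) e)"
| "traverse v a bs (Tuple x y) = Tuple (traverse v a bs x) (traverse v a bs y)"
| "traverse v a bs (Proj e i) = Proj (traverse v a bs e) i"
| "traverse v a bs (InL s e) = InL s (traverse v a bs e)"
| "traverse v a bs (InR t e) = InR t (traverse v a bs e)"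
| "traverse v a bs (Case e f g) =
     Case (traverse v a bs e) (traverse v a bs f) (traverse v a bs g)"
| "traverse v a bs (And P Q) = And (traverse v a bs P) (traverse v a bs Q)"
| "traverse v a bs (Or P Q) = Or (traverse v a bs P) (traverse v a bs Q)"
| "traverse v a bs (Imp P Q) = Imp (traverse v a bs P) (traverse v a bs Q)"
| "traverse v a bs (Forall t P) = Forall t (traverse v a (Suc (hd bs) # tl bs) P)"
| "traverse v a bs (Exists t P) = Exists t (traverse v a (Suc (hd bs) # tl bs) P)"
| "traverse v a bs (Lift e) = Lift (traverse v a bs e)"
| "traverse v a bs Top = Top"
| "traverse v a bs Bot = Bot"
| "traverse v a bs (Eq t e e') = Eq t (traverse v a bs e) (traverse v a bs e')"
| "traverse v a bs (AxC t f) = AxC t f"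

text \<open>
  Weakening past \<open>k\<close> new frames.  Free variables \<open>Var p q\<close> with \<open>p \<ge> d\<close> become
  \<open>Var (p + k) q\<close>.  Inside \<open>j\<close> binders of the original frame, the slots \<open>q < j\<close> of frame \<open>d\<close>
  are bound by the traversed term: these binders now bind in the innermost new frame, so the
  bound variables stay where they are, and the old frame (now \<open>k\<close> further out) loses those
  \<open>j\<close> slots.  This makes \<open>frame_up\<close> take terms over \<open>C\<close> to terms over \<open>Gs @ C\<close>.
\<close>

definition frame_up_var :: "nat \<Rightarrow> nat list \<Rightarrow> nat \<Rightarrow> nat \<Rightarrow> 'v::small_sets tm" where
  "frame_up_var k bs p q =
     (let d = length bs - 1; j = last bs in
      if p < d then Var p q
      else if p = d then (if q < j then Var p q else Var (p + k) (q - j))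
      else Var (p + k) q)"

definition frame_up :: "nat \<Rightarrow> 'v::small_sets tm \<Rightarrow> 'v tm" where
  "frame_up k e = (if k = 0 then e else traverse (frame_up_var k) (\<lambda>m. m + k) [0] e)"

definition slot_up_var :: "nat list \<Rightarrow> nat \<Rightarrow> nat \<Rightarrow> 'v::small_sets tm" where
  "slot_up_var bs p q = (if p = length bs - 1 \<and> q \<ge> last bs then Var p (Suc q) else Var p q)"

definition slot_up :: "'v::small_sets tm \<Rightarrow> 'v tm" where
  "slot_up e = traverse slot_up_var (\<lambda>m. m) [0] e"

definition subst_var :: "'v::small_sets tm \<Rightarrow> nat list \<Rightarrow> nat \<Rightarrow> nat \<Rightarrow> 'v tm" where
  "subst_var e' bs p q =
     (let d = length bs - 1; j = last bs in
      if p = d \<and> q = j then frame_up d ((slot_up ^^ j) e')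
      else if p = d \<and> q > j then Var p (q - 1)
      else Var p q)"

definition subst :: "'v::small_sets tm \<Rightarrow> 'v tm \<Rightarrow> 'v tm" where
  "subst e e' = traverse (subst_var e') (\<lambda>m. m) [0] e"


section \<open>Interpretation of terms\<close>

text \<open>
  Elements of \<open>\<lbrakk>\<Gamma>; C\<rbrakk> = \<lbrakk>\<Gamma>\<rbrakk> \<times> \<triangleleft>\<lbrakk>C\<rbrakk>\<close> at a stage are stacks of lists of values, of the same
  shape as the context.
\<close>

fun env :: "'v::small_sets ctx \<Rightarrow> nat \<Rightarrow> 'v list list \<Rightarrow> bool" where
  "env [] n \<gamma> \<longleftrightarrow> \<gamma> = []"
| "env (G # C) n \<gamma> \<longleftrightarrow>
     (\<exists>g \<gamma>'. \<gamma> = g # \<gamma>' \<and> list_all2 (\<lambda>t x. x \<in> elts (tob t n)) G g \<and> env C (Suc n) \<gamma>')"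

fun env_res :: "'v::small_sets ctx \<Rightarrow> nat \<Rightarrow> nat \<Rightarrow> 'v list list \<Rightarrow> 'v list list" where
  "env_res (G # C) n k (g # \<gamma>) =
     map2 (\<lambda>t x. tres t n k x) G g # env_res C (Suc n) (Suc k) \<gamma>"
| "env_res C n k \<gamma> = []"

fun fix_sem :: "(nat \<Rightarrow> 'v list list \<Rightarrow> 'v) \<Rightarrow> 'v::small_sets ctx \<Rightarrow> nat \<Rightarrow> 'v list list \<Rightarrow> 'v" where
  "fix_sem F C 0 \<gamma> = F 0 (push vstar \<gamma>)"
| "fix_sem F C (Suc n) \<gamma> = F (Suc n) (push (fix_sem F C n (env_res C (Suc n) n \<gamma>)) \<gamma>)"

primrec sem :: "'v::small_sets tm \<Rightarrow> 'v ctx \<Rightarrow> nat \<Rightarrow> 'v list list \<Rightarrow> 'v" where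
  "sem (Const T a) C n \<gamma> = a"
| "sem (Odot T S f x) C n \<gamma> = vapp (sem f C n \<gamma>) (sem x C n \<gamma>)"
| "sem (Pure e) C n \<gamma> = enc (if sem e C n \<gamma> = vtruth True then {..n} else {})"
| "sem (Var p q) C n \<gamma> = tres (C ! p ! q) (n + p) n (\<gamma> ! p ! q)"
| "sem (Lam t e) C n \<gamma> =
     vfam n (\<lambda>k. vlam (tob t k) (\<lambda>x. sem e (push t C) k (push x (env_res C n k \<gamma>))))"
| "sem (App f e) C n \<gamma> = vapp (vcomp (sem f C n \<gamma>) n) (sem e C n \<gamma>)"
| "sem (Delay e) C n \<gamma> = (case n of 0 \<Rightarrow> vstar | Suc m \<Rightarrow> sem e ([] # C) m ([] # \<gamma>))"
| "sem (Adv k e) C n \<gamma> =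
     sem e (drop k C) (Suc n) (env_res (drop k C) (n + k) (Suc n) (drop k \<gamma>))"
| "sem (Fix t e) C n \<gamma> = fix_sem (sem e (push (TLater t) C)) C n \<gamma>"
| "sem (Tuple a b) C n \<gamma> = vpair (sem a C n \<gamma>) (sem b C n \<gamma>)"
| "sem (Proj e i) C n \<gamma> = (case i of L \<Rightarrow> vfst (sem e C n \<gamma>) | R \<Rightarrow> vsnd (sem e C n \<gamma>))"
| "sem (InL s e) C n \<gamma> = vinl (sem e C n \<gamma>)"
| "sem (InR t e) C n \<gamma> = vinr (sem e C n \<gamma>)"
| "sem (Case e f g) C n \<gamma> =
     (let v = sem e C n \<gamma> in
      if vfst v = vnat 0 then vapp (vcomp (sem f C n \<gamma>) n) (vsnd v)
      else vapp (vcomp (sem g C n \<gamma>) n) (vsnd v))"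
| "sem (And P Q) C n \<gamma> = enc (dec (sem P C n \<gamma>) \<inter> dec (sem Q C n \<gamma>))"
| "sem (Or P Q) C n \<gamma> = enc (dec (sem P C n \<gamma>) \<union> dec (sem Q C n \<gamma>))"
| "sem (Imp P Q) C n \<gamma> =
     enc {k. k \<le> n \<and> (\<forall>j\<le>k. j \<in> dec (sem P C n \<gamma>) \<longrightarrow> j \<in> dec (sem Q C n \<gamma>))}"
| "sem (Forall t P) C n \<gamma> =
     enc {k. k \<le> n \<and> (\<forall>j\<le>k. \<forall>x\<in>elts (tob t j).
       j \<in> dec (sem P (push t C) j (push x (env_res C n j \<gamma>))))}"
| "sem (Exists t P) C n \<gamma> =
     enc {k. k \<le> n \<and> (\<exists>x\<in>elts (tob t k).
       k \<in> dec (sem P (push t C) k (push x (env_res C n k \<gamma>))))}"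
| "sem (Lift e) C n \<gamma> =
     enc (case n of 0 \<Rightarrow> {0} | Suc m \<Rightarrow> insert 0 (Suc ` dec (sem e C n \<gamma>)))"
| "sem Top C n \<gamma> = enc {..n}"
| "sem Bot C n \<gamma> = enc {}"
| "sem (Eq t e e') C n \<gamma> =
     enc {k. k \<le> n \<and> tres t n k (sem e C n \<gamma>) = tres t n k (sem e' C n \<gamma>)}"
| "sem (AxC t f) C n \<gamma> = f n"


section \<open>Judgmental equality\<close>

inductive jeq :: "'v::small_sets ctx \<Rightarrow> 'v tm \<Rightarrow> 'v tm \<Rightarrow> 'v ty \<Rightarrow> bool"
    ("(_/ \<turnstile> _/ \<equiv> _/ \<Colon> _)" [51, 51, 51, 51] 50) where
  jeq_refl: "C \<turnstile> e \<Colon> t \<Longrightarrow> C \<turnstile> e \<equiv> e \<Colon> t"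
| jeq_sym: "C \<turnstile> e \<equiv> e' \<Colon> t \<Longrightarrow> C \<turnstile> e' \<equiv> e \<Colon> t"
| jeq_trans: "C \<turnstile> e \<equiv> e' \<Colon> t \<Longrightarrow> C \<turnstile> e' \<equiv> e'' \<Colon> t \<Longrightarrow> C \<turnstile> e \<equiv> e'' \<Colon> t"
| "C \<turnstile> f \<equiv> f' \<Colon> TDelta (vfunset T S) \<Longrightarrow> C \<turnstile> x \<equiv> x' \<Colon> TDelta T \<Longrightarrow>
     C \<turnstile> Odot T S f x \<equiv> Odot T S f' x' \<Colon> TDelta S"
| "C \<turnstile> e \<equiv> e' \<Colon> TDelta vProp \<Longrightarrow> C \<turnstile> Pure e \<equiv> Pure e' \<Colon> TOmega"
| "(t # G) # C \<turnstile> e \<equiv> e' \<Colon> s \<Longrightarrow> G # C \<turnstile> Lam t e \<equiv> Lam t e' \<Colon> TFun t s"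
| "C \<turnstile> f \<equiv> f' \<Colon> TFun t s \<Longrightarrow> C \<turnstile> e \<equiv> e' \<Colon> t \<Longrightarrow> C \<turnstile> App f e \<equiv> App f' e' \<Colon> s"
| "C \<noteq> [] \<Longrightarrow> [] # C \<turnstile> e \<equiv> e' \<Colon> t \<Longrightarrow> C \<turnstile> Delay e \<equiv> Delay e' \<Colon> TLater t"
| "n > 0 \<Longrightarrow> length Gs = n \<Longrightarrow> C \<turnstile> e \<equiv> e' \<Colon> TLater t \<Longrightarrow> Gs @ C \<turnstile> Adv n e \<equiv> Adv n e' \<Colon> t"
| "(TLater t # G) # C \<turnstile> e \<equiv> e' \<Colon> t \<Longrightarrow> G # C \<turnstile> Fix t e \<equiv> Fix t e' \<Colon> t"
| "C \<turnstile> a \<equiv> a' \<Colon> t \<Longrightarrow> C \<turnstile> b \<equiv> b' \<Colon> s \<Longrightarrow> C \<turnstile> Tuple a b \<equiv> Tuple a' b' \<Colon> TProd t s"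
| "C \<turnstile> e \<equiv> e' \<Colon> TProd t s \<Longrightarrow> C \<turnstile> Proj e L \<equiv> Proj e' L \<Colon> t"
| "C \<turnstile> e \<equiv> e' \<Colon> TProd t s \<Longrightarrow> C \<turnstile> Proj e R \<equiv> Proj e' R \<Colon> s"
| "C \<turnstile> e \<equiv> e' \<Colon> t \<Longrightarrow> C \<turnstile> InL s e \<equiv> InL s e' \<Colon> TSum t s"
| "C \<turnstile> e \<equiv> e' \<Colon> s \<Longrightarrow> C \<turnstile> InR t e \<equiv> InR t e' \<Colon> TSum t s"
| "C \<turnstile> e \<equiv> e' \<Colon> TSum t s \<Longrightarrow> C \<turnstile> f \<equiv> f' \<Colon> TFun t r \<Longrightarrow> C \<turnstile> g \<equiv> g' \<Colon> TFun s r \<Longrightarrow>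
     C \<turnstile> Case e f g \<equiv> Case e' f' g' \<Colon> r"
| "C \<turnstile> P \<equiv> P' \<Colon> TOmega \<Longrightarrow> C \<turnstile> Q \<equiv> Q' \<Colon> TOmega \<Longrightarrow> C \<turnstile> And P Q \<equiv> And P' Q' \<Colon> TOmega"
| "C \<turnstile> P \<equiv> P' \<Colon> TOmega \<Longrightarrow> C \<turnstile> Q \<equiv> Q' \<Colon> TOmega \<Longrightarrow> C \<turnstile> Or P Q \<equiv> Or P' Q' \<Colon> TOmega"
| "C \<turnstile> P \<equiv> P' \<Colon> TOmega \<Longrightarrow> C \<turnstile> Q \<equiv> Q' \<Colon> TOmega \<Longrightarrow> C \<turnstile> Imp P Q \<equiv> Imp P' Q' \<Colon> TOmega"
| "(t # G) # C \<turnstile> P \<equiv> P' \<Colon> TOmega \<Longrightarrow> G # C \<turnstile> Forall t P \<equiv> Forall t P' \<Colon> TOmega"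
| "(t # G) # C \<turnstile> P \<equiv> P' \<Colon> TOmega \<Longrightarrow> G # C \<turnstile> Exists t P \<equiv> Exists t P' \<Colon> TOmega"
| "C \<turnstile> e \<equiv> e' \<Colon> TLater TOmega \<Longrightarrow> C \<turnstile> Lift e \<equiv> Lift e' \<Colon> TOmega"
| "C \<turnstile> a \<equiv> a' \<Colon> t \<Longrightarrow> C \<turnstile> b \<equiv> b' \<Colon> t \<Longrightarrow> C \<turnstile> Eq t a b \<equiv> Eq t a' b' \<Colon> TOmega"
| fun_beta: "C \<turnstile> App (Lam t e) e' \<Colon> s \<Longrightarrow> C \<turnstile> subst e e' \<Colon> s \<Longrightarrow>
     C \<turnstile> App (Lam t e) e' \<equiv> subst e e' \<Colon> s"
| fun_eta: "C \<turnstile> f \<Colon> TFun t s \<Longrightarrow> C \<turnstile> Lam t (App (slot_up f) (Var 0 0)) \<Colon> TFun t s \<Longrightarrow>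
     C \<turnstile> f \<equiv> Lam t (App (slot_up f) (Var 0 0)) \<Colon> TFun t s"
| prod_beta1: "C \<turnstile> a \<Colon> t \<Longrightarrow> C \<turnstile> b \<Colon> s \<Longrightarrow> C \<turnstile> Proj (Tuple a b) L \<equiv> a \<Colon> t"
| prod_beta2: "C \<turnstile> a \<Colon> t \<Longrightarrow> C \<turnstile> b \<Colon> s \<Longrightarrow> C \<turnstile> Proj (Tuple a b) R \<equiv> b \<Colon> s"
| prod_eta: "C \<turnstile> e \<Colon> TProd t s \<Longrightarrow> C \<turnstile> e \<equiv> Tuple (Proj e L) (Proj e R) \<Colon> TProd t s"
| sum_beta1: "C \<turnstile> a \<Colon> t \<Longrightarrow> C \<turnstile> f \<Colon> TFun t r \<Longrightarrow> C \<turnstile> g \<Colon> TFun s r \<Longrightarrow>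
     C \<turnstile> Case (InL s a) f g \<equiv> App f a \<Colon> r"
| sum_beta2: "C \<turnstile> b \<Colon> s \<Longrightarrow> C \<turnstile> f \<Colon> TFun t r \<Longrightarrow> C \<turnstile> g \<Colon> TFun s r \<Longrightarrow>
     C \<turnstile> Case (InR t b) f g \<equiv> App g b \<Colon> r"
| odot_beta: "C \<noteq> [] \<Longrightarrow> f \<in> elts (vfunset T S) \<Longrightarrow> x \<in> elts T \<Longrightarrow>
     C \<turnstile> Odot T S (Const (vfunset T S) f) (Const T x) \<equiv> Const S (vapp f x) \<Colon> TDelta S"
| adv_delay: "n > 0 \<Longrightarrow> length Gs = n \<Longrightarrow> C \<noteq> [] \<Longrightarrow> [] # C \<turnstile> e \<Colon> t \<Longrightarrow>
     Gs @ C \<turnstile> frame_up (n - 1) e \<Colon> t \<Longrightarrow>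
     Gs @ C \<turnstile> Adv n (Delay e) \<equiv> frame_up (n - 1) e \<Colon> t"
| delay_adv: "C \<turnstile> e \<Colon> TLater t \<Longrightarrow> C \<turnstile> e \<equiv> Delay (Adv 1 e) \<Colon> TLater t"
| fix_unfold: "C \<turnstile> Fix t e \<Colon> t \<Longrightarrow> C \<turnstile> subst e (Delay (frame_up 1 (Fix t e))) \<Colon> t \<Longrightarrow>
     C \<turnstile> Fix t e \<equiv> subst e (Delay (frame_up 1 (Fix t e))) \<Colon> t"
| jeq_sem: "C \<turnstile> e \<Colon> t \<Longrightarrow> C \<turnstile> e' \<Colon> t \<Longrightarrow>
     (\<And>n \<gamma>. env C n \<gamma> \<Longrightarrow> sem e C n \<gamma> = sem e' C n \<gamma>) \<Longrightarrow> C \<turnstile> e \<equiv> e' \<Colon> t"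


section \<open>Provability\<close>

definition Later :: "'v::small_sets tm \<Rightarrow> 'v tm" where
  "Later P = Lift (Delay P)"

type_synonym 'v hyps = "'v tm list list"

definition wf_seq :: "'v::small_sets ctx \<Rightarrow> 'v hyps \<Rightarrow> 'v tm \<Rightarrow> bool" where
  "wf_seq C H P \<longleftrightarrow> length H = length C \<and>
     (\<forall>k<length H. \<forall>Q\<in>set (H ! k). drop k C \<turnstile> Q \<Colon> TOmega) \<and> C \<turnstile> P \<Colon> TOmega"

text \<open>
  The premise \<open>wf_seq\<close> of each rule expresses that the displayed formulas of the conclusion are
  well typed.
\<close>

inductive prov :: "'v::small_sets ctx \<Rightarrow> 'v hyps \<Rightarrow> 'v tm \<Rightarrow> bool"
    ("(_/ \<parallel> _/ \<turnstile> _)" [51, 51, 51] 50) where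
  asm: "wf_seq C H (frame_up k P) \<Longrightarrow> k < length H \<Longrightarrow> P \<in> set (H ! k) \<Longrightarrow> C \<parallel> H \<turnstile> frame_up k P"
| topI: "wf_seq C H Top \<Longrightarrow> C \<parallel> H \<turnstile> Top"
| botE: "wf_seq C H P \<Longrightarrow> C \<parallel> H \<turnstile> Bot \<Longrightarrow> C \<parallel> H \<turnstile> P"
| andI: "wf_seq C H (And P Q) \<Longrightarrow> C \<parallel> H \<turnstile> P \<Longrightarrow> C \<parallel> H \<turnstile> Q \<Longrightarrow> C \<parallel> H \<turnstile> And P Q"
| andE1: "wf_seq C H P \<Longrightarrow> C \<parallel> H \<turnstile> And P Q \<Longrightarrow> C \<parallel> H \<turnstile> P"
| andE2: "wf_seq C H Q \<Longrightarrow> C \<parallel> H \<turnstile> And P Q \<Longrightarrow> C \<parallel> H \<turnstile> Q"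
| orI1: "wf_seq C H (Or P Q) \<Longrightarrow> C \<parallel> H \<turnstile> P \<Longrightarrow> C \<parallel> H \<turnstile> Or P Q"
| orI2: "wf_seq C H (Or P Q) \<Longrightarrow> C \<parallel> H \<turnstile> Q \<Longrightarrow> C \<parallel> H \<turnstile> Or P Q"
| orE: "wf_seq C (H0 # H) X \<Longrightarrow> C \<parallel> H0 # H \<turnstile> Or P Q \<Longrightarrow>
     C \<parallel> (P # H0) # H \<turnstile> X \<Longrightarrow> C \<parallel> (Q # H0) # H \<turnstile> X \<Longrightarrow> C \<parallel> H0 # H \<turnstile> X"
| impI: "wf_seq C (H0 # H) (Imp P Q) \<Longrightarrow> C \<parallel> (P # H0) # H \<turnstile> Q \<Longrightarrow> C \<parallel> H0 # H \<turnstile> Imp P Q"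
| impE: "wf_seq C H Q \<Longrightarrow> C \<parallel> H \<turnstile> Imp P Q \<Longrightarrow> C \<parallel> H \<turnstile> P \<Longrightarrow> C \<parallel> H \<turnstile> Q"
| forallI: "wf_seq (G # C) (H0 # H) (Forall t P) \<Longrightarrow>
     (t # G) # C \<parallel> map slot_up H0 # H \<turnstile> P \<Longrightarrow> G # C \<parallel> H0 # H \<turnstile> Forall t P"
| forallE: "wf_seq C H (subst P e) \<Longrightarrow> C \<parallel> H \<turnstile> Forall t P \<Longrightarrow> C \<turnstile> e \<Colon> t \<Longrightarrow> C \<parallel> H \<turnstile> subst P e"
| existsI: "wf_seq C H (Exists t P) \<Longrightarrow> C \<turnstile> e \<Colon> t \<Longrightarrow> C \<parallel> H \<turnstile> subst P e \<Longrightarrow> C \<parallel> H \<turnstile> Exists t P"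
| existsE: "wf_seq (G # C) (H0 # H) X \<Longrightarrow> G # C \<parallel> H0 # H \<turnstile> Exists t P \<Longrightarrow>
     (t # G) # C \<parallel> (P # map slot_up H0) # H \<turnstile> slot_up X \<Longrightarrow> G # C \<parallel> H0 # H \<turnstile> X"
| deltaI: "wf_seq C H (Forall (TDelta T) P) \<Longrightarrow>
     (\<And>a. a \<in> elts T \<Longrightarrow> C \<parallel> H \<turnstile> subst P (Const T a)) \<Longrightarrow> C \<parallel> H \<turnstile> Forall (TDelta T) P"
| sumE: "wf_seq (G # C) (H0 # H) X \<Longrightarrow> G # C \<turnstile> e \<Colon> TSum t s \<Longrightarrow>
     (t # G) # C \<parallel> (Eq (TSum t s) (slot_up e) (InL s (Var 0 0)) # map slot_up H0) # H
       \<turnstile> slot_up X \<Longrightarrow>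
     (s # G) # C \<parallel> (Eq (TSum t s) (slot_up e) (InR t (Var 0 0)) # map slot_up H0) # H
       \<turnstile> slot_up X \<Longrightarrow>
     G # C \<parallel> H0 # H \<turnstile> X"
| laterI: "wf_seq C H (Later P) \<Longrightarrow> [] # C \<parallel> [] # H \<turnstile> P \<Longrightarrow> C \<parallel> H \<turnstile> Later P"
| later_mono: "wf_seq C H (Later Q) \<Longrightarrow> C \<parallel> H \<turnstile> Later P \<Longrightarrow> [] # C \<parallel> [P] # H \<turnstile> Q \<Longrightarrow>
     C \<parallel> H \<turnstile> Later Q"
| later_and: "wf_seq C H (Later (And P Q)) \<Longrightarrow> C \<parallel> H \<turnstile> Later P \<Longrightarrow> C \<parallel> H \<turnstile> Later Q \<Longrightarrow>
     C \<parallel> H \<turnstile> Later (And P Q)"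
| later_or: "wf_seq C H (Or (Later P) (Later Q)) \<Longrightarrow> C \<parallel> H \<turnstile> Later (Or P Q) \<Longrightarrow>
     C \<parallel> H \<turnstile> Or (Later P) (Later Q)"
| loeb: "wf_seq C (H0 # H) P \<Longrightarrow> C \<parallel> (Later (frame_up 1 P) # H0) # H \<turnstile> P \<Longrightarrow>
     C \<parallel> H0 # H \<turnstile> P"
| later_eq: "wf_seq C H (Eq (TLater t) (Delay e1) (Delay e2)) \<Longrightarrow>
     C \<parallel> H \<turnstile> Later (Eq t e1 e2) \<Longrightarrow> C \<parallel> H \<turnstile> Eq (TLater t) (Delay e1) (Delay e2)"
| eqI: "wf_seq C H (Eq t e1 e2) \<Longrightarrow> C \<turnstile> e1 \<equiv> e2 \<Colon> t \<Longrightarrow> C \<parallel> H \<turnstile> Eq t e1 e2"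
| eqE: "wf_seq (G # C) H (subst P e2) \<Longrightarrow> (t # G) # C \<turnstile> P \<Colon> TOmega \<Longrightarrow>
     G # C \<parallel> H \<turnstile> Eq t e1 e2 \<Longrightarrow> G # C \<parallel> H \<turnstile> subst P e1 \<Longrightarrow> G # C \<parallel> H \<turnstile> subst P e2"
| pureI: "wf_seq C H (Pure (Const vProp (vtruth A))) \<Longrightarrow> A \<Longrightarrow>
     C \<parallel> H \<turnstile> Pure (Const vProp (vtruth A))"
| inl_inj: "wf_seq C H (Eq t a b) \<Longrightarrow> C \<parallel> H \<turnstile> Eq (TSum t s) (InL s a) (InL s b) \<Longrightarrow>
     C \<parallel> H \<turnstile> Eq t a b"
| inr_inj: "wf_seq C H (Eq s a b) \<Longrightarrow> C \<parallel> H \<turnstile> Eq (TSum t s) (InR t a) (InR t b) \<Longrightarrow>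
     C \<parallel> H \<turnstile> Eq s a b"
| inl_inr: "wf_seq C H Bot \<Longrightarrow> C \<parallel> H \<turnstile> Eq (TSum t s) (InL s a) (InR t b) \<Longrightarrow> C \<parallel> H \<turnstile> Bot"

definition provable :: "'v::small_sets tm \<Rightarrow> bool" where
  "provable P \<longleftrightarrow> [[]] \<parallel> [[]] \<turnstile> P"


section \<open>Delay and the extension\<close>

text \<open>The closed constant denoting a morphism: its transpose \<open>1 \<rightarrow> \<lbrakk>TFun t s\<rbrakk>\<close>.\<close>

definition mor_const :: "'v::small_sets ty \<Rightarrow> 'v ty \<Rightarrow> (nat \<Rightarrow> 'v \<Rightarrow> 'v) \<Rightarrow> 'v tm" where
  "mor_const t s f = AxC (TFun t s) (\<lambda>n. vfam n (\<lambda>k. vlam (tob t k) (f k)))"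

definition is_Delay ::
    "'v::small_sets ty \<Rightarrow> 'v presheaf \<Rightarrow> (nat \<Rightarrow> 'v \<Rightarrow> 'v) \<Rightarrow> (nat \<Rightarrow> 'v \<Rightarrow> 'v) \<Rightarrow> bool" where
  "is_Delay A D \<theta> \<theta>' \<longleftrightarrow> isomorphism (TSum A (TLater (TAx D))) (TAx D) \<theta> \<theta>'"

definition MK :: "'v::small_sets ty \<Rightarrow> 'v presheaf \<Rightarrow> (nat \<Rightarrow> 'v \<Rightarrow> 'v) \<Rightarrow> 'v tm" where
  "MK A D \<theta> = mor_const (TSum A (TLater (TAx D))) (TAx D) \<theta>"

definition PROJ :: "'v::small_sets ty \<Rightarrow> 'v presheaf \<Rightarrow> (nat \<Rightarrow> 'v \<Rightarrow> 'v) \<Rightarrow> 'v tm" where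
  "PROJ A D \<theta>' = mor_const (TAx D) (TSum A (TLater (TAx D))) \<theta>'"

definition ret :: "'v::small_sets ty \<Rightarrow> 'v presheaf \<Rightarrow> (nat \<Rightarrow> 'v \<Rightarrow> 'v) \<Rightarrow> 'v tm" where
  "ret A D \<theta> = Lam A (App (MK A D \<theta>) (InL (TLater (TAx D)) (Var 0 0)))"

definition step :: "'v::small_sets ty \<Rightarrow> 'v presheaf \<Rightarrow> (nat \<Rightarrow> 'v \<Rightarrow> 'v) \<Rightarrow> 'v tm" where
  "step A D \<theta> = Lam (TLater (TAx D)) (App (MK A D \<theta>) (InR A (Var 0 0)))"

definition extT :: "'v::small_sets ty \<Rightarrow> 'v ty \<Rightarrow> 'v presheaf \<Rightarrow> 'v ty" where
  "extT A B D = TFun (TFun (TLater B) B) (TFun (TFun A B) (TFun (TAx D) B))"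

text \<open>
  Slots of the frame inside \<open>\<lambda>s f d\<close>: \<open>d = 0\<close>, \<open>f = 1\<close>, \<open>s = 2\<close>, \<open>\<mu> = 3\<close>; each of the two
  branches binds one more, and under \<open>Delay\<close> this frame has index 1.
\<close>

definition ext :: "'v::small_sets ty \<Rightarrow> 'v ty \<Rightarrow> 'v presheaf \<Rightarrow> (nat \<Rightarrow> 'v \<Rightarrow> 'v) \<Rightarrow> 'v tm" where
  "ext A B D \<theta>' =
     Fix (extT A B D)
      (Lam (TFun (TLater B) B) (Lam (TFun A B) (Lam (TAx D)
        (Case (App (PROJ A D \<theta>') (Var 0 0))
          (Lam A (App (Var 0 2) (Var 0 0)))
          (Lam (TLater (TAx D))
            (App (Var 0 3)
              (Delay (App (App (App (Adv 1 (Var 0 4)) (Var 1 3)) (Var 1 2))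
                          (Adv 1 (Var 0 0))))))))))"

end

(*
  Judgmental equality contains every semantic equality, so a closed formula whose denotation is the
  full sieve is judgmentally equal to Top and hence provable.  It remains to compute in the topos of
  trees.  There the guarded recursion of ext is an ordinary recursion on the stage: at stage n + 1,
  a value inr w of PROJ is sent to s applied to the value of ext on w at stage n.  The first two laws
  read off this recursion, and uniqueness is an induction on the stage.
*)
theory Submission
  imports Defs
begin

section \<open>Small sets\<close>

text \<open>\<open>vset\<close> inverts \<open>elts\<close> only on the range of
  \<open>elts\<close>, so each set formed with \<open>vset\<close> has to be shown small before its
  elements can be read off.\<close>

definition small :: "'v::small_sets set \<Rightarrow> bool" where
  "small X \<longleftrightarrow> X \<in> range elts"

lemma small_elts [simp]: "small (elts x)"
  by (simp add: small_def)

lemma elts_vset [simp]: "small X \<Longrightarrow> elts (vset X) = X"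
  unfolding small_def vset_def by (rule f_inv_into_f)

lemma small_subset: "small X \<Longrightarrow> Y \<subseteq> X \<Longrightarrow> small Y"
  unfolding small_def by (auto simp only: elts_subset)

lemma small_image [simp]:
  fixes f :: "'v::small_sets \<Rightarrow> 'v"
  shows "small X \<Longrightarrow> small (f ` X)"
  unfolding small_def by (auto simp only: elts_replacement)

lemma small_empty [simp]: "small {}"
  by (rule small_subset[OF small_elts[of undefined]]) simp

lemma small_Pow: "small X \<Longrightarrow> small {y. elts y \<subseteq> X}"
  unfolding small_def by (auto simp only: elts_Pow)

text \<open>Replacement collects the codes \<open>vset (F x)\<close>, and the union axiom applies to
  the collection.\<close>

lemma small_UN [simp]:
  fixes F :: "'v::small_sets \<Rightarrow> 'v set"
  assumes "small X" "\<And>x. x \<in> X \<Longrightarrow> small (F x)"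
  shows "small (\<Union>x\<in>X. F x)"
proof -
  let ?z = "vset ((\<lambda>x. vset (F x)) ` X)"
  have "\<Union> (elts ` elts ?z) = (\<Union>x\<in>X. F x)"
    using assms by simp
  then show ?thesis
    using elts_Union[of ?z] by (simp add: small_def)
qed

text \<open>Pairing is derived: two power sets over the empty set yield two distinct elements
  \<open>a\<close> and \<open>b\<close>, and replacement sends them to \<open>x\<close> and
  \<open>y\<close>.\<close>

lemma small_doubleton [simp]: "small {x, y :: 'v::small_sets}"
proof -
  define a b :: 'v where "a = vset {}" and "b = vset {a}"
  have a: "elts a = {}"
    by (simp add: a_def)
  have "elts z \<subseteq> {} \<longleftrightarrow> z = a" for z
    using elts_ext[of z a] a by (metis subset_empty)
  then have "{z. elts z \<subseteq> {}} = {a}"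
    by simp
  moreover have "small {z :: 'v. elts z \<subseteq> {}}"
    by (rule small_Pow[OF small_empty])
  ultimately have one: "small {a}"
    by (simp only:)
  then have b: "elts b = {a}"
    by (simp add: b_def)
  have "{a, b} \<subseteq> {z. elts z \<subseteq> {a}}"
    by (simp add: a b)
  then have "small ((\<lambda>z. if z = a then x else y) ` {a, b})"
    by (rule small_image[OF small_subset[OF small_Pow[OF one]]])
  moreover have "a \<noteq> b"
    using a b by (metis insert_not_empty)
  then have "(\<lambda>z. if z = a then x else y) ` {a, b} = {x, y}"
    by auto
  ultimately show ?thesis
    by (simp only:)
qed

lemma small_singleton [simp]: "small {x}"
  using small_doubleton[of x x] by simp

lemma small_Un [simp]:
  assumes "small X" "small Y"
  shows "small (X \<union> Y)"
proof -
  have "small (\<Union>z\<in>{vset X, vset Y}. elts z)"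
    by (rule small_UN) auto
  then show ?thesis
    using assms by simp
qed

lemma small_insert [simp]: "small X \<Longrightarrow> small (insert x X)"
  using small_Un[of "{x}" X] by simp

lemma small_finite: "finite X \<Longrightarrow> small X"
  by (induction rule: finite_induct) auto

lemma small_finite_UN:
  "finite I \<Longrightarrow> (\<And>i. i \<in> I \<Longrightarrow> small (F i)) \<Longrightarrow> small (\<Union>i\<in>I. F i)"
  by (induction rule: finite_induct) auto

lemma vset_inject: "small X \<Longrightarrow> small Y \<Longrightarrow> vset X = vset Y \<longleftrightarrow> X = Y"
  by (metis elts_vset)

section \<open>Kuratowski pairs, numerals, tags, function graphs and families\<close>

lemma vpair_inject [simp]: "vpair x y = vpair x' y' \<longleftrightarrow> x = x' \<and> y = y'"
  unfolding vpair_def by (auto simp: vset_inject doubleton_eq_iff)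

lemma vfst_vpair [simp]: "vfst (vpair x y) = x"
  unfolding vfst_def by simp

lemma vsnd_vpair [simp]: "vsnd (vpair x y) = y"
  unfolding vsnd_def by simp

lemma elts_vnat: "elts (vnat n) = vnat ` {..<n}"
  by (induction n) (simp_all add: lessThan_Suc small_finite)

text \<open>In the absence of foundation, \<open>vnat m \<in> vnat m\<close> is no contradiction by
  itself. It makes \<open>vnat m\<close> equal to an earlier numeral, which the induction hypothesis
  excludes.\<close>

lemma vnat_neq: "m < n \<Longrightarrow> vnat m \<noteq> (vnat n :: 'v::small_sets)"
proof (induction m arbitrary: n rule: less_induct)
  case (less m)
  show ?case
  proof
    assume "vnat m = (vnat n :: 'v)"
    moreover have "(vnat m :: 'v) \<in> elts (vnat n)"
      unfolding elts_vnat using less.prems by blast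
    ultimately have "(vnat m :: 'v) \<in> vnat ` {..<m}"
      using elts_vnat[of m] by metis
    then obtain j where "j < m" "(vnat j :: 'v) = vnat m"
      by (metis imageE lessThan_iff)
    with less.IH show False by blast
  qed
qed

lemma vnat_inject [simp]: "vnat m = vnat n \<longleftrightarrow> m = n"
  using vnat_neq by (metis linorder_neqE_nat)

text \<open>The tags are compared with \<open>vset {}\<close> because simp unfolds
  \<open>vnat 0\<close> to it.\<close>

lemma vfst_vinl [simp]: "vfst (vinl x) = vset {}" and vsnd_vinl [simp]: "vsnd (vinl x) = x"
  by (simp_all add: vinl_def)

lemma vfst_vinr [simp]: "vfst (vinr x) \<noteq> vset {}" and vsnd_vinr [simp]: "vsnd (vinr x) = x"
  using vnat_inject[of 1 0] by (simp_all add: vinr_def del: vnat_inject)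

lemma vapp_vlam [simp]: "x \<in> elts T \<Longrightarrow> vapp (vlam T f) x = f x"
  unfolding vapp_def vlam_def by auto

lemma vlam_cong: "(\<And>x. x \<in> elts T \<Longrightarrow> f x = g x) \<Longrightarrow> vlam T f = vlam T g"
  unfolding vlam_def by (metis (no_types, lifting) image_cong)

lemma vcomp_vfam [simp]: "k \<le> n \<Longrightarrow> vcomp (vfam n F) k = F k"
  unfolding vcomp_def vapp_def vfam_def by (auto simp: small_finite)

lemma vfam_cong: "(\<And>k. k \<le> n \<Longrightarrow> F k = G k) \<Longrightarrow> vfam n F = vfam n G"
  unfolding vfam_def by (metis (no_types, lifting) atMost_iff image_cong)

text \<open>Restriction in an exponential is truncation of families.\<close>

lemma vfam_vcomp [simp]: "k \<le> n \<Longrightarrow> vfam k (vcomp (vfam n F)) = vfam k F"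
  by (rule vfam_cong) simp

text \<open>Finiteness guarantees that the numerals of the members of \<open>S\<close> form a small
  set.\<close>

lemma dec_enc [simp]: "finite S \<Longrightarrow> dec (enc S :: 'v::small_sets) = S"
  unfolding dec_def enc_def by (auto simp: small_finite)

section \<open>Smallness of products, function sets and sets of families\<close>

lemma small_vpair_image:
  assumes "small X" "small Y"
  shows "small {vpair x y | x y. x \<in> X \<and> y \<in> Y}"
proof -
  have "small (\<Union>x\<in>X. vpair x ` Y)"
    using assms by simp
  moreover have "(\<Union>x\<in>X. vpair x ` Y) = {vpair x y | x y. x \<in> X \<and> y \<in> Y}"
    by auto
  ultimately show ?thesis by simp
qed

text \<open>A graph is a subset of the product of domain and codomain, so all graphs lie in one
  power set.\<close>

lemma small_vlam:
  assumes "small Y"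
  shows "small {vlam T f | f. \<forall>x\<in>elts T. f x \<in> Y}"
  by (rule small_subset[OF small_Pow[OF small_vpair_image[OF small_elts[of T] assms]]])
    (auto simp: vlam_def)

lemma small_vfam:
  assumes "\<And>k. k \<le> n \<Longrightarrow> small (Y k)"
  shows "small {vfam n F | F. \<forall>k\<le>n. F k \<in> Y k}"
proof -
  have "small (vnat ` {..n})" "small (\<Union>k\<in>{..n}. Y k)"
    by (simp add: small_finite) (rule small_finite_UN, simp_all add: assms)
  from small_Pow[OF small_vpair_image[OF this]] show ?thesis
    by (rule small_subset) (fastforce simp: vfam_def small_finite)
qed


section \<open>Types as presheaves\<close>

lemma elts_tob_TProd [simp]:
  "elts (tob (TProd t s) n) = {vpair x y | x y. x \<in> elts (tob t n) \<and> y \<in> elts (tob s n)}"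
  by (simp add: small_vpair_image)

lemma elts_tob_TSum [simp]:
  "elts (tob (TSum t s) n) = vinl ` elts (tob t n) \<union> vinr ` elts (tob s n)"
  by simp

text \<open>With naturality forgotten, the elements are arbitrary families of functions, which form
  a small set.\<close>

lemma elts_tob_TFun [simp]:
  "elts (tob (TFun t s) n) = {vfam n (\<lambda>k. vlam (tob t k) (f k)) | f.
       \<forall>k\<le>n. \<forall>x\<in>elts (tob t k). f k x \<in> elts (tob s k) \<and>
         (\<forall>j\<le>k. f j (tres t k j x) = tres s k j (f k x))}"
proof -
  have "small {vfam n F | F. \<forall>k\<le>n. F k \<in>
      {vlam (tob t k) f | f. \<forall>x\<in>elts (tob t k). f x \<in> elts (tob s k)}}"
    by (rule small_vfam) (rule small_vlam, simp)
  then have "small {vfam n (\<lambda>k. vlam (tob t k) (f k)) | f.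
       \<forall>k\<le>n. \<forall>x\<in>elts (tob t k). f k x \<in> elts (tob s k) \<and>
         (\<forall>j\<le>k. f j (tres t k j x) = tres s k j (f k x))}"
    by (rule small_subset) blast
  then show ?thesis by simp
qed

lemma elts_tob_TLater [simp]:
  "elts (tob (TLater t) 0) = {vstar}" "elts (tob (TLater t) (Suc n)) = elts (tob t n)"
  by simp_all

text \<open>Each stage has only finitely many sieves.\<close>

lemma elts_tob_TOmega [simp]:
  "elts (tob TOmega n) = {enc S | S. S \<subseteq> {..n} \<and> (\<forall>k\<in>S. \<forall>j\<le>k. j \<in> S)}"
proof -
  have "small (enc ` Pow {..n} :: 'a set)"
    by (intro small_finite) simp
  then have "small {enc S :: 'a | S. S \<subseteq> {..n} \<and> (\<forall>k\<in>S. \<forall>j\<le>k. j \<in> S)}"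
    by (rule small_subset) auto
  then show ?thesis by simp
qed

declare tob.simps(2-6) [simp del]

section \<open>Restriction maps and environments\<close>

lemma is_presheaf_psh: "is_presheaf (psh_ob I) (psh_res I)"
  using Rep_presheaf[of I] by (auto simp: psh_ob_def psh_res_def)

text \<open>Induction on the type. For an exponential, the natural family \<open>f\<close> that
  represents \<open>x\<close> also represents its truncation.\<close>

lemma tres_in_tob: "x \<in> elts (tob t n) \<Longrightarrow> k \<le> n \<Longrightarrow> tres t n k x \<in> elts (tob t k)"
proof (induction t arbitrary: x n k)
  case (TFun t s)
  then obtain f where f: "x = vfam n (\<lambda>k. vlam (tob t k) (f k))"
    "\<forall>k\<le>n. \<forall>x\<in>elts (tob t k). f k x \<in> elts (tob s k) \<and>
         (\<forall>j\<le>k. f j (tres t k j x) = tres s k j (f k x))"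
    by auto
  have "tres (TFun t s) n k x = vfam k (\<lambda>k. vlam (tob t k) (f k))"
    using f(1) TFun.prems by simp
  moreover have "\<forall>k'\<le>k. \<forall>x\<in>elts (tob t k'). f k' x \<in> elts (tob s k') \<and>
         (\<forall>j\<le>k'. f j (tres t k' j x) = tres s k' j (f k' x))"
    using f(2) TFun.prems by auto
  ultimately show ?case
    unfolding elts_tob_TFun by blast
next
  case (TLater t)
  then show ?case by (cases n; cases k) auto
next
  case TOmega
  then obtain S where S: "x = enc S" "S \<subseteq> {..n}" "\<forall>k\<in>S. \<forall>j\<le>k. j \<in> S"
    by auto
  then have "finite S" by (meson finite_atMost finite_subset)
  then have "tres TOmega n k x = enc (S \<inter> {..k})"
    using S by simp
  then show ?case
    unfolding elts_tob_TOmega using S by (intro CollectI exI[of _ "S \<inter> {..k}"]) auto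
next
  case (TAx I)
  then show ?case using is_presheaf_psh[of I] by (simp add: is_presheaf_def)
qed auto

text \<open>The semantics of \<open>Var 0 q\<close>, and of \<open>Eq\<close> at its top stage,
  restricts from a stage to itself.\<close>

lemma tres_self [simp]: "x \<in> elts (tob t n) \<Longrightarrow> tres t n n x = x"
proof (induction t arbitrary: x n)
  case (TLater t)
  then show ?case by (cases n) auto
next
  case TOmega
  then obtain S where S: "x = enc S" "S \<subseteq> {..n}" by auto
  moreover from S have "finite S" by (meson finite_atMost finite_subset)
  ultimately show ?case by (simp add: inf.absorb1)
next
  case (TAx I)
  then show ?case using is_presheaf_psh[of I] by (simp add: is_presheaf_def)
qed auto

lemma vapp_in_tob:
  "h \<in> elts (tob (TFun t s) n) \<Longrightarrow> k \<le> n \<Longrightarrow> x \<in> elts (tob t k) \<Longrightarrow>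
    vapp (vcomp h k) x \<in> elts (tob s k)"
  by auto

lemma global_element_transpose:
  assumes "morphism t s f"
  shows "global_element (TFun t s) (\<lambda>n. vfam n (\<lambda>k. vlam (tob t k) (f k)))"
proof -
  have "\<And>n. vfam n (\<lambda>k. vlam (tob t k) (f k)) \<in> elts (tob (TFun t s) n)"
    unfolding elts_tob_TFun using assms unfolding morphism_def by blast
  then show ?thesis
    by (simp add: global_element_def del: elts_tob_TFun)
qed

lemma env_env_res: "env C n \<gamma> \<Longrightarrow> k \<le> n \<Longrightarrow> env C k (env_res C n k \<gamma>)"
proof (induction C arbitrary: n k \<gamma>)
  case (Cons G C)
  then show ?case
    by (auto simp: list_all2_conv_all_nth tres_in_tob)
qed simp


section \<open>Semantic validity implies provability\<close>

text \<open>\<open>[[]]\<close> is the only environment of the empty context, so the second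
  assumption is exactly what \<open>jeq_sem\<close> requires for equality with
  \<open>Top\<close>.\<close>

lemma provable_if_valid:
  fixes P :: "'v::small_sets tm"
  assumes "[[]] \<turnstile> P \<Colon> TOmega" and "\<And>n. sem P [[]] n [[]] = enc {..n}"
  shows "provable P"
proof -
  have [simp]: "[[]] \<turnstile> (Top :: 'v tm) \<Colon> TOmega"
    "[[TOmega]] \<turnstile> (Var 0 0 :: 'v tm) \<Colon> TOmega"
    using typed.intros(4)[of 0 "[[TOmega]]" 0] by (auto intro: typed.intros)
  \<comment> \<open>The predicate for \<open>eqE\<close> is a variable of type
    \<open>TOmega\<close>: rewriting then turns the proof of \<open>Top\<close> into one of
    \<open>P\<close>.\<close>
  have subst: "subst (Var 0 0) e = e" for e :: "'v tm"
    by (simp add: subst_def subst_var_def frame_up_def)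
  have "[[]] \<turnstile> Top \<equiv> P \<Colon> TOmega"
    using assms by (intro jeq_sem) auto
  then have "[[]] \<parallel> [[]] \<turnstile> Eq TOmega Top P"
    by (intro eqI) (auto simp: wf_seq_def assms intro: typed.intros)
  moreover have "[[]] \<parallel> [[]] \<turnstile> subst (Var 0 0) (Top :: 'v tm)"
    unfolding subst by (intro topI) (auto simp: wf_seq_def)
  ultimately have "[[]] \<parallel> [[]] \<turnstile> subst (Var 0 0) P"
    by (rule eqE[rotated 2]) (auto simp: wf_seq_def subst assms)
  then show ?thesis
    by (simp add: provable_def subst)
qed

text \<open>The quantifier evaluates \<open>P\<close> at all earlier stages in restricted
  environments, hence the assumption on every stage and environment.\<close>

lemma sem_Forall_valid:
  assumes "\<And>n x \<gamma>. x \<in> elts (tob t n) \<Longrightarrow> env (G # C) n \<gamma> \<Longrightarrow>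
      sem P ((t # G) # C) n (push x \<gamma>) = enc {..n}"
    and "env (G # C) n \<gamma>"
  shows "sem (Forall t P) (G # C) n \<gamma> = enc {..n}"
proof -
  have "{k. k \<le> n \<and> (\<forall>j\<le>k. \<forall>x\<in>elts (tob t j).
       j \<in> dec (sem P ((t # G) # C) j (push x (env_res (G # C) n j \<gamma>))))} = {..n}"
    using assms(1)[OF _ env_env_res[OF assms(2)]] by auto
  then show ?thesis
    by simp
qed


section \<open>The denotation of the extension\<close>

declare tob.simps [simp del] tres.simps(7) [simp del] elts_tob_TFun [simp del]

text \<open>An element of an exponential seen as HOL functions, one per stage.\<close>

definition fam :: "'v::small_sets \<Rightarrow> nat \<Rightarrow> 'v \<Rightarrow> 'v" where
  "fam h k x = vapp (vcomp h k) x"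

text \<open>\<open>vset {}\<close> is \<open>vnat 0\<close>, the tag of \<open>vinl\<close>.\<close>

primrec ext_val :: "(nat \<Rightarrow> 'v::small_sets \<Rightarrow> 'v) \<Rightarrow> (nat \<Rightarrow> 'v \<Rightarrow> 'v) \<Rightarrow> (nat \<Rightarrow> 'v \<Rightarrow> 'v) \<Rightarrow>
    nat \<Rightarrow> 'v \<Rightarrow> 'v" where
  "ext_val \<theta>' s f 0 d =
     (if vfst (\<theta>' 0 d) = vset {} then f 0 (vsnd (\<theta>' 0 d)) else s 0 vstar)"
| "ext_val \<theta>' s f (Suc m) d =
     (if vfst (\<theta>' (Suc m) d) = vset {} then f (Suc m) (vsnd (\<theta>' (Suc m) d))
      else s (Suc m) (ext_val \<theta>' s f m (vsnd (\<theta>' (Suc m) d))))"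

lemma ext_val_cong:
  "(\<And>j. j \<le> n \<Longrightarrow> s j = s' j) \<Longrightarrow> (\<And>j. j \<le> n \<Longrightarrow> f j = f' j) \<Longrightarrow>
    ext_val \<theta>' s f n d = ext_val \<theta>' s' f' n d"
  by (induction n arbitrary: d) auto

text \<open>Variables and binders truncate \<open>s\<close> and \<open>f\<close> to the current
  stage; this is harmless since \<open>ext_val\<close> at \<open>n\<close> reads them only up to
  \<open>n\<close>.\<close>

lemma ext_val_restrict [simp]:
  "ext_val \<theta>' (fam (vfam n (vcomp s))) (fam (vfam n (vcomp f))) n d =
    ext_val \<theta>' (fam s) (fam f) n d"
  by (rule ext_val_cong) (simp_all add: fam_def fun_eq_iff)

text \<open>The intended denotation of \<open>ext\<close>. Each abstraction may lower the stage, so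
  \<open>s\<close>, \<open>f\<close> and the last argument live at stages \<open>k\<close>,
  \<open>j\<close> and \<open>i\<close> that decrease from \<open>n\<close>.\<close>

definition ext_sem ::
    "'v::small_sets ty \<Rightarrow> 'v ty \<Rightarrow> 'v presheaf \<Rightarrow> (nat \<Rightarrow> 'v \<Rightarrow> 'v) \<Rightarrow> nat \<Rightarrow> 'v" where
  "ext_sem A B D \<theta>' n =
     vfam n (\<lambda>k. vlam (tob (TFun (TLater B) B) k) (\<lambda>s.
     vfam k (\<lambda>j. vlam (tob (TFun A B) j) (\<lambda>f.
     vfam j (\<lambda>i. vlam (tob (TAx D) i) (ext_val \<theta>' (fam s) (fam f) i))))))"

lemma ext_sem_apply2:
  assumes "s \<in> elts (tob (TFun (TLater B) B) n)" "f \<in> elts (tob (TFun A B) n)"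
  shows "vapp (vcomp (vapp (vcomp (ext_sem A B D \<theta>' n) n) s) n) f =
    vfam n (\<lambda>i. vlam (tob (TAx D) i) (ext_val \<theta>' (fam s) (fam f) i))"
  using assms by (simp add: ext_sem_def)

text \<open>The value held by the recursion variable of \<open>ext\<close>.\<close>

definition later_ext_sem ::
    "'v::small_sets ty \<Rightarrow> 'v ty \<Rightarrow> 'v presheaf \<Rightarrow> (nat \<Rightarrow> 'v \<Rightarrow> 'v) \<Rightarrow> nat \<Rightarrow> 'v" where
  "later_ext_sem A B D \<theta>' n = (case n of 0 \<Rightarrow> vstar | Suc m \<Rightarrow> ext_sem A B D \<theta>' m)"

text \<open>Entering a binder restricts the environment; the slot of the recursion variable keeps
  its form.\<close>

lemma tres_later_ext_sem [simp]:
  "k \<le> n \<Longrightarrow> tres (TLater (extT A B D)) n k (later_ext_sem A B D \<theta>' n) =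
    later_ext_sem A B D \<theta>' k"
  by (auto simp: later_ext_sem_def extT_def ext_sem_def split: nat.split)

lemma tres_ext_sem [simp]:
  "k \<le> n \<Longrightarrow> tres (extT A B D) n k (ext_sem A B D \<theta>' n) = ext_sem A B D \<theta>' k"
  by (simp add: extT_def ext_sem_def)

lemma sem_mor_const [simp]:
  "x \<in> elts (tob t n) \<Longrightarrow> vapp (vcomp (sem (mor_const t s f) C n \<gamma>) n) x = f n x"
  by (simp add: mor_const_def)

lemma isomorphism_in_tob:
  assumes "isomorphism t s f g"
  shows "x \<in> elts (tob t n) \<Longrightarrow> f n x \<in> elts (tob s n)"
    and "y \<in> elts (tob s n) \<Longrightarrow> g n y \<in> elts (tob t n)"
    and "x \<in> elts (tob t n) \<Longrightarrow> g n (f n x) = x"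
    and "y \<in> elts (tob s n) \<Longrightarrow> f n (g n y) = y"
  using assms by (auto simp: isomorphism_def morphism_def)

lemma PROJ_cases:
  assumes "is_Delay A D \<theta> \<theta>'" "d \<in> elts (tob (TAx D) n)"
  obtains a where "a \<in> elts (tob A n)" "\<theta>' n d = vinl a" "\<theta> n (vinl a) = d"
  | w where "w \<in> elts (tob (TLater (TAx D)) n)" "\<theta>' n d = vinr w" "\<theta> n (vinr w) = d"
proof -
  have "\<theta>' n d \<in> elts (tob (TSum A (TLater (TAx D))) n)" and "\<theta> n (\<theta>' n d) = d"
    using isomorphism_in_tob(2,4)[OF assms(1)[unfolded is_Delay_def] assms(2)] by this
  then show thesis
    unfolding elts_tob_TSum by (metis that UnE imageE)
qed

text \<open>Extracting the body from \<open>ext\<close> allows the \<open>Fix\<close> to be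
  evaluated while its body stays folded.\<close>

definition ext_body ::
    "'v::small_sets ty \<Rightarrow> 'v ty \<Rightarrow> 'v presheaf \<Rightarrow> (nat \<Rightarrow> 'v \<Rightarrow> 'v) \<Rightarrow> 'v tm" where
  "ext_body A B D \<theta>' = (case ext A B D \<theta>' of Fix t e \<Rightarrow> e)"

lemma ext_eq_Fix: "ext A B D \<theta>' = Fix (extT A B D) (ext_body A B D \<theta>')"
  by (simp add: ext_def ext_body_def)

text \<open>One unfolding of the recursion: if the recursion variable holds the delayed denotation,
  the body returns the denotation. The rest of the environment is arbitrary because
  \<open>ext\<close> is closed.\<close>

lemma sem_ext_body:
  assumes "is_Delay A D \<theta> \<theta>'"
  shows "sem (ext_body A B D \<theta>') ((TLater (extT A B D) # G) # C) n
      ((later_ext_sem A B D \<theta>' n # g) # \<gamma>) = ext_sem A B D \<theta>' n"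
proof -
  let ?S = "TFun (TLater B) B" and ?F = "TFun A B" and ?D = "TAx D"
  have *: "sem (Case (App (PROJ A D \<theta>') (Var 0 0))
          (Lam A (App (Var 0 2) (Var 0 0)))
          (Lam (TLater (TAx D))
            (App (Var 0 3)
              (Delay (App (App (App (Adv 1 (Var 0 4)) (Var 1 3)) (Var 1 2))
                          (Adv 1 (Var 0 0)))))))
       ((?D # ?F # ?S # TLater (extT A B D) # G) # C) i
       ((d # vfam i (vcomp f) # vfam i (vcomp s) # later_ext_sem A B D \<theta>' i # g') # \<gamma>') =
    ext_val \<theta>' (fam s) (fam f) i d"
    if d: "d \<in> elts (tob ?D i)" and f: "vfam i (vcomp f) \<in> elts (tob ?F i)"
      and s: "vfam i (vcomp s) \<in> elts (tob ?S i)" for d f s i g' \<gamma>'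
    using assms d
  proof (cases rule: PROJ_cases)
    case (1 a)
    then show ?thesis
      using d by (cases i) (simp_all add: PROJ_def fam_def)
  next
    case (2 w)
    show ?thesis
    proof (cases i)
      case 0
      then show ?thesis
        using 2 d by (simp add: PROJ_def fam_def)
    next
      case (Suc m)
      \<comment> \<open>The argument of \<open>Delay\<close> is evaluated at stage \<open>m\<close>.
        There \<open>Adv 1\<close> of the recursion variable is \<open>ext_sem\<close> at
        \<open>m\<close>, and \<open>s\<close> and \<open>f\<close> arrive truncated to
        \<open>m\<close>.\<close>
      have fs: "vfam m (vcomp f) \<in> elts (tob ?F m)" "vfam m (vcomp s) \<in> elts (tob ?S m)"
        using tres_in_tob[OF f, of m] tres_in_tob[OF s, of m] Suc by simp_all
      show ?thesis
        using 2 d Suc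
        by (simp add: PROJ_def fam_def later_ext_sem_def
            ext_sem_apply2[OF fs(2,1)])
    qed
  qed
  show ?thesis
    unfolding ext_body_def ext_def tm.case ext_sem_def
    \<comment> \<open>Only the abstractions are evaluated; the inner \<open>Case\<close> stays
      folded to match \<open>*\<close>, up to the rewriting of \<open>1\<close> to
      \<open>Suc 0\<close>.\<close>
    apply (simp del: sem.simps(6,7,8,14) tres.simps(5))
    apply (intro vfam_cong vlam_cong)
    apply (simp del: sem.simps(6,7,8,14) tres.simps(5))
    apply (rule *[unfolded One_nat_def])
    subgoal by simp
    subgoal for k s j f i d using tres_in_tob[of f "TFun A B" j i] by simp
    subgoal for k s j f i d using tres_in_tob[of s "TFun (TLater B) B" k i] by simp
    done
qed

text \<open>The induction generalizes over environments because \<open>fix_sem\<close> computes the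
  previous stage in the restricted one.\<close>

lemma sem_ext:
  assumes "is_Delay A D \<theta> \<theta>'"
  shows "sem (ext A B D \<theta>') (G # C) n (g # \<gamma>) = ext_sem A B D \<theta>' n"
proof (induction n arbitrary: g \<gamma>)
  case 0
  show ?case
    using sem_ext_body[OF assms, of _ _ _ 0]
    by (simp add: ext_eq_Fix later_ext_sem_def)
next
  case (Suc n)
  show ?case
    using sem_ext_body[OF assms, of _ _ _ "Suc n"] Suc
    by (simp add: ext_eq_Fix later_ext_sem_def)
qed

section \<open>Values of applications of \<open>ext\<close>, \<open>ret\<close> and
  \<open>step\<close>\<close>

lemma sem_ext_apply2:
  fixes u v :: "'v::small_sets tm"
  assumes "is_Delay A D \<theta> \<theta>'"
    and "sem u (G # C) n (g # \<gamma>) \<in> elts (tob (TFun (TLater B) B) n)"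
    and "sem v (G # C) n (g # \<gamma>) \<in> elts (tob (TFun A B) n)"
  shows "sem (App (App (ext A B D \<theta>') u) v) (G # C) n (g # \<gamma>) =
    vfam n (\<lambda>i. vlam (tob (TAx D) i)
      (ext_val \<theta>' (fam (sem u (G # C) n (g # \<gamma>))) (fam (sem v (G # C) n (g # \<gamma>))) i))"
  using ext_sem_apply2[OF assms(2,3)] by (simp add: sem_ext[OF assms(1)])

lemma sem_ext_apply3:
  assumes "is_Delay A D \<theta> \<theta>'"
    and "sem u (G # C) n (g # \<gamma>) \<in> elts (tob (TFun (TLater B) B) n)"
    and "sem v (G # C) n (g # \<gamma>) \<in> elts (tob (TFun A B) n)"
    and "sem w (G # C) n (g # \<gamma>) \<in> elts (tob (TAx D) n)"
  shows "sem (App (App (App (ext A B D \<theta>') u) v) w) (G # C) n (g # \<gamma>) =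
    ext_val \<theta>' (fam (sem u (G # C) n (g # \<gamma>))) (fam (sem v (G # C) n (g # \<gamma>))) n
      (sem w (G # C) n (g # \<gamma>))"
  using sem_ext_apply2[OF assms(1-3)] assms(4) by (subst sem.simps(6)) simp

lemma sem_ret:
  assumes "sem e (G # C) n (g # \<gamma>) \<in> elts (tob A n)"
  shows "sem (App (ret A D \<theta>) e) (G # C) n (g # \<gamma>) = \<theta> n (vinl (sem e (G # C) n (g # \<gamma>)))"
  using assms by (simp add: ret_def MK_def)

lemma sem_step:
  assumes "sem e (G # C) n (g # \<gamma>) \<in> elts (tob (TLater (TAx D)) n)"
  shows "sem (App (step A D \<theta>) e) (G # C) n (g # \<gamma>) = \<theta> n (vinr (sem e (G # C) n (g # \<gamma>)))"
  using assms by (simp add: step_def MK_def del: tres.simps(5))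

lemma MK_in_tob:
  assumes "is_Delay A D \<theta> \<theta>'"
  shows "a \<in> elts (tob A n) \<Longrightarrow> \<theta> n (vinl a) \<in> elts (tob (TAx D) n)"
    and "w \<in> elts (tob (TLater (TAx D)) n) \<Longrightarrow> \<theta> n (vinr w) \<in> elts (tob (TAx D) n)"
    and "a \<in> elts (tob A n) \<Longrightarrow> \<theta>' n (\<theta> n (vinl a)) = vinl a"
    and "w \<in> elts (tob (TLater (TAx D)) n) \<Longrightarrow> \<theta>' n (\<theta> n (vinr w)) = vinr w"
  using isomorphism_in_tob(1,3)[OF assms[unfolded is_Delay_def]] by simp_all

section \<open>Recursion equations and uniqueness at the level of values\<close>

lemma ext_val_ret:
  assumes "is_Delay A D \<theta> \<theta>'" "a \<in> elts (tob A n)"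
  shows "ext_val \<theta>' s f n (\<theta> n (vinl a)) = f n a"
  using MK_in_tob[OF assms(1)] assms(2) by (cases n) simp_all

lemma ext_val_step:
  assumes "is_Delay A D \<theta> \<theta>'" "w \<in> elts (tob (TLater (TAx D)) n)"
  shows "ext_val \<theta>' s f n (\<theta> n (vinr w)) =
    s n (case n of 0 \<Rightarrow> vstar | Suc m \<Rightarrow> ext_val \<theta>' s f m w)"
  using MK_in_tob[OF assms(1)] assms(2) by (cases n) simp_all

text \<open>Every \<open>d\<close> is \<open>\<theta>\<close> of an injection. On the left one both
  sides are \<open>f\<close>; on the right one both apply \<open>s\<close> to a value one stage
  earlier, covered by the induction hypothesis. The laws are bounded by \<open>n\<close> because the
  premises of the uniqueness law may hold only up to some stage.\<close>

lemma ext_val_unique: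
  assumes "is_Delay A D \<theta> \<theta>'"
    and "\<And>j a. j \<le> n \<Longrightarrow> a \<in> elts (tob A j) \<Longrightarrow> h j (\<theta> j (vinl a)) = f j a"
    and "\<And>j w. j \<le> n \<Longrightarrow> w \<in> elts (tob (TLater (TAx D)) j) \<Longrightarrow>
      h j (\<theta> j (vinr w)) = s j (case j of 0 \<Rightarrow> vstar | Suc m \<Rightarrow> h m w)"
    and "d \<in> elts (tob (TAx D) n)"
  shows "h n d = ext_val \<theta>' s f n d"
  using assms(2-)
proof (induction n arbitrary: d)
  case 0
  from assms(1) 0(3) show ?case
    by (cases rule: PROJ_cases) (use 0 in \<open>force+\<close>)
next
  case (Suc n)
  from assms(1) Suc(4) show ?case
  proof (cases rule: PROJ_cases)
    case (1 a)
    then show ?thesis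
      using Suc.prems(1)[of "Suc n" a] by simp
  next
    case (2 w)
    then have "h n w = ext_val \<theta>' s f n w"
      by (intro Suc.IH) (simp_all add: Suc.prems)
    with 2 show ?thesis
      using Suc.prems(2)[of "Suc n" w] by simp
  qed
qed


section \<open>Typing and validity of the three laws\<close>

text \<open>The lookup is a premise, so the rule unifies with any type and simp checks the
  slot.\<close>

lemma typed_Var: "p < length C \<Longrightarrow> q < length (C ! p) \<Longrightarrow> C ! p ! q = t \<Longrightarrow> C \<turnstile> Var p q \<Colon> t"
  using typed.intros(4) by blast

lemma typed_Adv_1: "C \<turnstile> e \<Colon> TLater t \<Longrightarrow> G # C \<turnstile> Adv 1 e \<Colon> t"
  using typed.intros(8)[of 1 "[G]"] by simp

lemmas typing = typed.intros(5-7,9,13-15,18,19,24) typed_Var typed_Adv_1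

lemma typed_mor_const: "morphism t s f \<Longrightarrow> C \<noteq> [] \<Longrightarrow> C \<turnstile> mor_const t s f \<Colon> TFun t s"
  unfolding mor_const_def by (intro typed.intros(25) global_element_transpose)

lemma typed_Delay_constants:
  assumes "is_Delay A D \<theta> \<theta>'"
  shows "C \<noteq> [] \<Longrightarrow> C \<turnstile> MK A D \<theta> \<Colon> TFun (TSum A (TLater (TAx D))) (TAx D)"
    and "C \<noteq> [] \<Longrightarrow> C \<turnstile> PROJ A D \<theta>' \<Colon> TFun (TAx D) (TSum A (TLater (TAx D)))"
  using assms typed_mor_const unfolding is_Delay_def isomorphism_def MK_def PROJ_def by blast+

lemma typed_ret:
  assumes "is_Delay A D \<theta> \<theta>'"
  shows "G # C \<turnstile> ret A D \<theta> \<Colon> TFun A (TAx D)"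
  unfolding ret_def by (rule typing typed_Delay_constants[OF assms] | simp)+

lemma typed_step:
  assumes "is_Delay A D \<theta> \<theta>'"
  shows "G # C \<turnstile> step A D \<theta> \<Colon> TFun (TLater (TAx D)) (TAx D)"
  unfolding step_def by (rule typing typed_Delay_constants[OF assms] | simp)+

lemma typed_ext:
  assumes "is_Delay A D \<theta> \<theta>'"
  shows "G # C \<turnstile> ext A B D \<theta>' \<Colon> TFun (TFun (TLater B) B) (TFun (TFun A B) (TFun (TAx D) B))"
  unfolding ext_def extT_def by (rule typing typed_Delay_constants[OF assms] | simp)+

section \<open>Validity of equations, implications and quantifier prefixes\<close>

lemma sem_Eq_valid:
  "sem u C n \<gamma> = sem v C n \<gamma> \<Longrightarrow> sem (Eq t u v) C n \<gamma> = enc {..n}"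
  by (simp add: atMost_def)

lemma sem_Imp_valid:
  assumes "\<And>k. k \<le> n \<Longrightarrow> k \<in> dec (sem P C n \<gamma>) \<Longrightarrow> k \<in> dec (sem Q C n \<gamma>)"
  shows "sem (Imp P Q) C n \<gamma> = enc {..n}"
proof -
  have "{k. k \<le> n \<and> (\<forall>j\<le>k. j \<in> dec (sem P C n \<gamma>) \<longrightarrow> j \<in> dec (sem Q C n \<gamma>))} = {..n}"
    using assms by auto
  then show ?thesis by simp
qed

text \<open>Reduces each law to its matrix over three explicit values; the last quantified variable
  has slot 0.\<close>

lemma provable_Forall3:
  assumes "[[v, u, t]] \<turnstile> P \<Colon> TOmega"
    and valid: "\<And>n x y z. x \<in> elts (tob t n) \<Longrightarrow> y \<in> elts (tob u n) \<Longrightarrow> z \<in> elts (tob v n) \<Longrightarrow>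
      sem P [[v, u, t]] n [[z, y, x]] = enc {..n}"
  shows "provable (Forall t (Forall u (Forall v P)))"
proof (rule provable_if_valid)
  show "[[]] \<turnstile> Forall t (Forall u (Forall v P)) \<Colon> TOmega"
    by (intro typing assms)
  have "sem P [[v, u, t]] n (push z \<gamma>) = enc {..n}"
    if "z \<in> elts (tob v n)" "env [[u, t]] n \<gamma>" for n z \<gamma>
    using that valid by (auto simp: list_all2_Cons1)
  then show "sem (Forall t (Forall u (Forall v P))) [[]] n [[]] = enc {..n}" for n
    by (intro sem_Forall_valid) (auto simp: list_all2_Cons1)
qed

section \<open>The three laws\<close>

lemma ext_ret_provable:
  assumes "is_Delay A D \<theta> \<theta>'"
  shows "provable
       (Forall (TFun (TLater B) B) (Forall (TFun A B) (Forall A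
          (Eq B
            (App (App (App (ext A B D \<theta>') (Var 0 2)) (Var 0 1)) (App (ret A D \<theta>) (Var 0 0)))
            (App (Var 0 1) (Var 0 0))))))"
proof (rule provable_Forall3)
  show "[[A, TFun A B, TFun (TLater B) B]] \<turnstile> Eq B
      (App (App (App (ext A B D \<theta>') (Var 0 2)) (Var 0 1)) (App (ret A D \<theta>) (Var 0 0)))
      (App (Var 0 1) (Var 0 0)) \<Colon> TOmega"
    by (rule typing typed_ext[OF assms] typed_ret[OF assms] | simp)+
  show "sem (Eq B
      (App (App (App (ext A B D \<theta>') (Var 0 2)) (Var 0 1)) (App (ret A D \<theta>) (Var 0 0)))
      (App (Var 0 1) (Var 0 0))) [[A, TFun A B, TFun (TLater B) B]] n [[a, f, s]] = enc {..n}"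
    if "s \<in> elts (tob (TFun (TLater B) B) n)" "f \<in> elts (tob (TFun A B) n)"
      "a \<in> elts (tob A n)" for n s f a
    \<comment> \<open>The first pass keeps applications folded for the rules on \<open>ext\<close>
      and \<open>ret\<close>; the second evaluates the remaining \<open>f a\<close>.\<close>
    using that
    by (intro sem_Eq_valid)
      (simp add: sem_ext_apply3[OF assms] sem_ret MK_in_tob[OF assms] ext_val_ret[OF assms]
        fam_def del: sem.simps(6) tres.simps(4), simp add: fam_def del: tres.simps(4))
qed

lemma ext_step_provable:
  assumes "is_Delay A D \<theta> \<theta>'"
  shows "provable
       (Forall (TFun (TLater B) B) (Forall (TFun A B) (Forall (TLater (TAx D))
          (Eq B
            (App (App (App (ext A B D \<theta>') (Var 0 2)) (Var 0 1)) (App (step A D \<theta>) (Var 0 0)))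
            (App (Var 0 2)
              (Delay (App (App (App (ext A B D \<theta>') (Var 1 2)) (Var 1 1))
                          (Adv 1 (Var 0 0)))))))))"
proof (rule provable_Forall3)
  show "[[TLater (TAx D), TFun A B, TFun (TLater B) B]] \<turnstile> Eq B
      (App (App (App (ext A B D \<theta>') (Var 0 2)) (Var 0 1)) (App (step A D \<theta>) (Var 0 0)))
      (App (Var 0 2) (Delay (App (App (App (ext A B D \<theta>') (Var 1 2)) (Var 1 1))
        (Adv 1 (Var 0 0))))) \<Colon> TOmega"
    by (rule typing typed_ext[OF assms] typed_step[OF assms] | simp del: One_nat_def)+
  fix n s f w
  assume s: "s \<in> elts (tob (TFun (TLater B) B) n)" and f: "f \<in> elts (tob (TFun A B) n)"
    and w: "w \<in> elts (tob (TLater (TAx D)) n)"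
  let ?C = "[[TLater (TAx D), TFun A B, TFun (TLater B) B]]" and ?\<gamma> = "[[w, f, s]]"
  have lhs: "sem (App (App (App (ext A B D \<theta>') (Var 0 2)) (Var 0 1)) (App (step A D \<theta>) (Var 0 0)))
      ?C n ?\<gamma> = fam s n (case n of 0 \<Rightarrow> vstar | Suc m \<Rightarrow> ext_val \<theta>' (fam s) (fam f) m w)"
    using s f w
    by (simp add: sem_ext_apply3[OF assms] sem_step MK_in_tob[OF assms] ext_val_step[OF assms]
        del: sem.simps(6) tres.simps(4,5))
  \<comment> \<open>The delayed argument one stage down: \<open>s\<close> and \<open>f\<close> occur
    truncated to \<open>m\<close>, and \<open>ext_val_restrict\<close> removes the
    truncation.\<close>
  have "sem (App (App (App (ext A B D \<theta>') (Var 1 2)) (Var 1 1)) (Adv 1 (Var 0 0)))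
      ([] # ?C) m ([] # ?\<gamma>) = ext_val \<theta>' (fam s) (fam f) m w" if n: "n = Suc m" for m
  proof -
    have "vfam m (vcomp s) \<in> elts (tob (TFun (TLater B) B) m)"
      "vfam m (vcomp f) \<in> elts (tob (TFun A B) m)"
      using tres_in_tob[OF s, of m] tres_in_tob[OF f, of m] n by simp_all
    then show ?thesis
      using w n by (simp add: sem_ext_apply3[OF assms] del: sem.simps(6))
  qed
  then show "sem (Eq B
      (App (App (App (ext A B D \<theta>') (Var 0 2)) (Var 0 1)) (App (step A D \<theta>) (Var 0 0)))
      (App (Var 0 2) (Delay (App (App (App (ext A B D \<theta>') (Var 1 2)) (Var 1 1))
        (Adv 1 (Var 0 0)))))) ?C n ?\<gamma> = enc {..n}"
    \<comment> \<open>Only the application on the right is unfolded, so that the left one still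
      matches \<open>lhs\<close>; at stage 0 both arguments of \<open>s\<close> are
      \<open>vstar\<close>.\<close>
    using s lhs
    by (intro sem_Eq_valid)
      (subst (2) sem.simps(6), cases n, simp_all add: fam_def del: sem.simps(6) tres.simps(4))
qed

lemma ext_unique_provable:
  assumes "is_Delay A D \<theta> \<theta>'"
  shows "provable
       (Forall (TFun (TLater B) B) (Forall (TFun A B) (Forall (TFun (TAx D) B)
          (Imp
            (Forall A
              (Eq B (App (Var 0 1) (App (ret A D \<theta>) (Var 0 0))) (App (Var 0 2) (Var 0 0))))
            (Imp
              (Forall (TLater (TAx D))
                (Eq B (App (Var 0 1) (App (step A D \<theta>) (Var 0 0)))
                  (App (Var 0 3) (Delay (App (Var 1 1) (Adv 1 (Var 0 0)))))))
              (Eq (TFun (TAx D) B)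
                (Var 0 0)
                (App (App (ext A B D \<theta>') (Var 0 2)) (Var 0 1))))))))"
    (is "provable (Forall ?S (Forall ?F (Forall ?H (Imp ?P (Imp ?Q ?E)))))")
proof (rule provable_Forall3)
  let ?C = "[[?H, ?F, ?S]]"
  show "?C \<turnstile> Imp ?P (Imp ?Q ?E) \<Colon> TOmega"
    by (rule typing typed_ext[OF assms] typed_step[OF assms] typed_ret[OF assms]
        | simp del: One_nat_def)+
  fix n s f h
  assume s: "s \<in> elts (tob ?S n)" and f: "f \<in> elts (tob ?F n)" and h: "h \<in> elts (tob ?H n)"
  let ?\<gamma> = "[[h, f, s]]"
  \<comment> \<open>If the premise is forced at \<open>j\<close>, its equation holds at each
    \<open>k \<le> j\<close>, in the environment truncated to \<open>k\<close>.\<close>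
  have P: "fam h k (\<theta> k (vinl a)) = fam f k a"
    if "j \<in> dec (sem ?P ?C n ?\<gamma>)" and k: "k \<le> j" and a: "a \<in> elts (tob A k)" for j k a
  proof -
    let ?C' = "[[A, ?H, ?F, ?S]]"
      and ?\<gamma>' = "[[a, vfam k (vcomp h), vfam k (vcomp f), vfam k (vcomp s)]]"
    have "j \<le> n"
      using that(1) by simp
    then have kn: "k \<le> n"
      using k by simp
    let ?u = "sem (App (Var 0 1) (App (ret A D \<theta>) (Var 0 0))) ?C' k ?\<gamma>'"
      and ?v = "sem (App (Var 0 2) (Var 0 0)) ?C' k ?\<gamma>'"
    have "k \<in> dec (sem (Eq B (App (Var 0 1) (App (ret A D \<theta>) (Var 0 0))) (App (Var 0 2) (Var 0 0)))
        ?C' k ?\<gamma>')"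
      using that kn by (simp del: sem.simps(4,6,23))
    then have eq: "tres B k k ?u = tres B k k ?v"
      by (simp del: sem.simps(4,6))
    have u: "?u = fam h k (\<theta> k (vinl a))"
      using a by (subst sem.simps(6)) (simp add: sem_ret fam_def del: sem.simps(6))
    have v: "?v = fam f k a"
      using a by (simp add: fam_def)
    have "fam h k (\<theta> k (vinl a)) \<in> elts (tob B k)" "fam f k a \<in> elts (tob B k)"
      unfolding fam_def
      using vapp_in_tob[OF h kn] vapp_in_tob[OF f kn] a MK_in_tob(1)[OF assms] by blast+
    then show ?thesis
      using eq unfolding u v by simp
  qed
  have Q: "fam h k (\<theta> k (vinr w)) = fam s k (case k of 0 \<Rightarrow> vstar | Suc m \<Rightarrow> fam h m w)"
    if "j \<in> dec (sem ?Q ?C n ?\<gamma>)" and k: "k \<le> j" and w: "w \<in> elts (tob (TLater (TAx D)) k)"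
    for j k w
  proof -
    let ?C' = "[[TLater (TAx D), ?H, ?F, ?S]]"
      and ?\<gamma>' = "[[w, vfam k (vcomp h), vfam k (vcomp f), vfam k (vcomp s)]]"
    have "j \<le> n"
      using that(1) by simp
    then have kn: "k \<le> n"
      using k by simp
    let ?d = "Delay (App (Var 1 1) (Adv 1 (Var 0 0))) :: 'a tm"
    let ?u = "sem (App (Var 0 1) (App (step A D \<theta>) (Var 0 0))) ?C' k ?\<gamma>'"
      and ?v = "sem (App (Var 0 3) ?d) ?C' k ?\<gamma>'"
    have "k \<in> dec (sem (Eq B (App (Var 0 1) (App (step A D \<theta>) (Var 0 0))) (App (Var 0 3) ?d))
        ?C' k ?\<gamma>')"
      using that kn by (simp del: sem.simps(4,6,7,23) One_nat_def)
    then have eq: "tres B k k ?u = tres B k k ?v"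
      by (simp del: sem.simps(4,6,7))
    have u: "?u = fam h k (\<theta> k (vinr w))"
      using w by (subst sem.simps(6)) (simp add: sem_step fam_def del: sem.simps(6) tres.simps(5))
    have d: "(case k of 0 \<Rightarrow> vstar | Suc m \<Rightarrow> fam h m w) \<in> elts (tob (TLater B) k)"
      using vapp_in_tob[OF h] kn w by (cases k) (simp_all add: fam_def)
    \<comment> \<open>At stage 0 a delayed term is \<open>vstar\<close>; at \<open>Suc m\<close> it
      is \<open>h\<close> at stage \<open>m\<close> applied to \<open>w\<close>.\<close>
    have "sem ?d ?C' k ?\<gamma>' = (case k of 0 \<Rightarrow> vstar | Suc m \<Rightarrow> fam h m w)"
      using w by (cases k) (simp_all add: fam_def)
    then have v: "?v = fam s k (case k of 0 \<Rightarrow> vstar | Suc m \<Rightarrow> fam h m w)"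
      by (simp add: fam_def del: sem.simps(7))
    have "fam h k (\<theta> k (vinr w)) \<in> elts (tob B k)"
      "fam s k (case k of 0 \<Rightarrow> vstar | Suc m \<Rightarrow> fam h m w) \<in> elts (tob B k)"
      unfolding fam_def[of h k] fam_def[of s]
      using vapp_in_tob[OF h kn] vapp_in_tob[OF s kn] w d MK_in_tob(2)[OF assms] by blast+
    then show ?thesis
      using eq unfolding u v by simp
  qed
  have E: "i \<in> dec (sem ?E ?C n ?\<gamma>)"
    if i: "i \<le> n" "i \<in> dec (sem ?P ?C n ?\<gamma>)" "i \<in> dec (sem ?Q ?C n ?\<gamma>)" for i
  proof -
    \<comment> \<open>Writing \<open>h\<close> through functions \<open>g k\<close> turns agreement
      of values up to \<open>i\<close> into equality of the families truncated to \<open>i\<close>,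
      which is what \<open>Eq\<close> tests at \<open>i\<close>.\<close>
    obtain g where g: "h = vfam n (\<lambda>k. vlam (tob (TAx D) k) (g k))"
      using h unfolding elts_tob_TFun by blast
    have "g k d = ext_val \<theta>' (fam s) (fam f) k d" if "k \<le> i" "d \<in> elts (tob (TAx D) k)" for k d
    proof -
      have "fam h k d = ext_val \<theta>' (fam s) (fam f) k d"
        using that by (intro ext_val_unique[OF assms] P[OF i(2)] Q[OF i(3)]) simp_all
      then show ?thesis
        using that i(1) by (simp add: fam_def g)
    qed
    then have "vfam i (vcomp h) =
        vfam i (\<lambda>k. vlam (tob (TAx D) k) (ext_val \<theta>' (fam s) (fam f) k))"
      unfolding g using i(1) by (simp cong: vfam_cong vlam_cong)
    moreover have "sem (App (App (ext A B D \<theta>') (Var 0 2)) (Var 0 1)) ?C n ?\<gamma> =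
        vfam n (\<lambda>k. vlam (tob (TAx D) k) (ext_val \<theta>' (fam s) (fam f) k))"
      using s f by (simp add: sem_ext_apply2[OF assms] del: sem.simps(6) tres.simps(4))
    ultimately show ?thesis
      using i(1) by (simp del: sem.simps(6))
  qed
  show "sem (Imp ?P (Imp ?Q ?E)) ?C n ?\<gamma> = enc {..n}"
  proof (rule sem_Imp_valid)
    fix j assume "j \<le> n" and "j \<in> dec (sem ?P ?C n ?\<gamma>)"
    \<comment> \<open>The inner implication is tested at every \<open>i \<le> j\<close>; downward
      closure of the sieve supplies the outer premise there.\<close>
    moreover from this(2) have "i \<in> dec (sem ?P ?C n ?\<gamma>)" if "i \<le> j" for i
      using that by simp
    ultimately show "j \<in> dec (sem (Imp ?Q ?E) ?C n ?\<gamma>)"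
      using E by (simp del: sem.simps(18,23))
  qed
qed

theorem mainTheorem3:
  fixes A B :: "'v::small_sets ty" and D :: "'v presheaf"
    and \<theta> \<theta>' :: "nat \<Rightarrow> 'v \<Rightarrow> 'v"
  assumes "is_Delay A D \<theta> \<theta>'"
  shows
    "provable
       (Forall (TFun (TLater B) B) (Forall (TFun A B) (Forall A
          (Eq B
            (App (App (App (ext A B D \<theta>') (Var 0 2)) (Var 0 1)) (App (ret A D \<theta>) (Var 0 0)))
            (App (Var 0 1) (Var 0 0))))))
     \<and>
     provable
       (Forall (TFun (TLater B) B) (Forall (TFun A B) (Forall (TLater (TAx D))
          (Eq B
            (App (App (App (ext A B D \<theta>') (Var 0 2)) (Var 0 1)) (App (step A D \<theta>) (Var 0 0)))
            (App (Var 0 2)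
              (Delay (App (App (App (ext A B D \<theta>') (Var 1 2)) (Var 1 1))
                          (Adv 1 (Var 0 0)))))))))
     \<and>
     provable
       (Forall (TFun (TLater B) B) (Forall (TFun A B) (Forall (TFun (TAx D) B)
          (Imp
            (Forall A
              (Eq B (App (Var 0 1) (App (ret A D \<theta>) (Var 0 0))) (App (Var 0 2) (Var 0 0))))
            (Imp
              (Forall (TLater (TAx D))
                (Eq B (App (Var 0 1) (App (step A D \<theta>) (Var 0 0)))
                  (App (Var 0 3) (Delay (App (Var 1 1) (Adv 1 (Var 0 0)))))))
              (Eq (TFun (TAx D) B)
                (Var 0 0)
                (App (App (ext A B D \<theta>') (Var 0 2)) (Var 0 1))))))))"
  using assms ext_ret_provable ext_step_provable ext_unique_provable by blast

end
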